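(* Let $k$ be a positive integer, let $\lambda_1,\lambda_2,\dots,\lambda_k$ be any nonzero complex scalars, and let $\varphi_1,\varphi_2,\dots,\varphi_k$ be any analytic self-maps of $\mathbb{D}$. Then the operator $\sum_{i=1}^k\lambda_i C_{\varphi_i}$ is compact on the Bloch space $\mathcal{B}$ if and only if $$\lim_{n\to\infty}\|\lambda_1\varphi_1^n+\lambda_2\varphi_2^n+\cdots+\lambda_k\varphi_k^n\|_{\mathcal{B}}=0.$$
   Context: $\mathbb{D}$ is the open unit disk in $\mathbb{C}$, and $H(\mathbb{D})$ is the class of functions analytic in $\mathbb{D}$. The Bloch space $\mathcal{B}$ is the Banach space of all $f\in H(\mathbb{D})$ with $\|f\|_\beta=\sup_{z\in\mathbb{D}}(1-|z|^2)|f'(z)|<\infty$, equipped with the norm $\|f\|_{\mathcal{B}}=|f(0)|+\|f\|_\beta$. An analytic self-map of $\mathbb{D}$ is an analytic function $\varphi:\mathbb{D}\to\mathbb{D}$; it induces the composition operator $C_\varphi f=f\circ\varphi$ on $H(\mathbb{D})$. Here $\varphi^n$ denotes the $n$-th pointwise power, $\varphi^n(z)=(\varphi(z))^n$. *)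

theory Defs
  imports "HOL-Complex_Analysis.Complex_Analysis"
begin

definition bloch_seminorm :: "(complex \<Rightarrow> complex) \<Rightarrow> real" where
  "bloch_seminorm f = (SUP z\<in>ball 0 1. (1 - (cmod z)\<^sup>2) * cmod (deriv f z))"

definition bloch_norm :: "(complex \<Rightarrow> complex) \<Rightarrow> real" where
  "bloch_norm f = cmod (f 0) + bloch_seminorm f"

text \<open>
  A real-valued supremum is only meaningful for a bounded family. The predicate
  \<open>bloch_function\<close> says that the supremum is finite. It holds for every bounded analytic
  function on the disk (lemma \<open>bloch_function_bounded\<close> below).
\<close>

definition bloch_function :: "(complex \<Rightarrow> complex) \<Rightarrow> bool" where
  "bloch_function f \<longleftrightarrow> f holomorphic_on ball 0 1 \<and>
     bdd_above ((\<lambda>z. (1 - (cmod z)\<^sup>2) * cmod (deriv f z)) ` ball 0 1)"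

text \<open>
  A function on the disk is represented by its extension by \<open>0\<close> to the whole plane, so that
  equality in \<open>bloch_space\<close> is equality on the disk.
\<close>

definition bloch_space :: "(complex \<Rightarrow> complex) set" where
  "bloch_space = {f. bloch_function f \<and> (\<forall>z. z \<notin> ball 0 1 \<longrightarrow> f z = 0)}"

definition bloch_dist :: "(complex \<Rightarrow> complex) \<Rightarrow> (complex \<Rightarrow> complex) \<Rightarrow> real" where
  "bloch_dist f g = (if f \<in> bloch_space \<and> g \<in> bloch_space
     then bloch_norm (\<lambda>z. f z - g z) else 0)"

text \<open>The value \<open>0\<close> off \<open>bloch_space\<close> serves the locale \<open>Metric_space\<close>, which asks for
  a nonnegative and symmetric distance on the whole type.\<close>

definition analytic_self_map :: "(complex \<Rightarrow> complex) \<Rightarrow> bool" where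
  "analytic_self_map \<phi> \<longleftrightarrow> \<phi> holomorphic_on ball 0 1 \<and> \<phi> ` ball 0 1 \<subseteq> ball 0 1"

definition comp_op :: "(complex \<Rightarrow> complex) \<Rightarrow> (complex \<Rightarrow> complex) \<Rightarrow> complex \<Rightarrow> complex" where
  "comp_op \<phi> f = (\<lambda>z. if z \<in> ball 0 1 then f (\<phi> z) else 0)"

lemma bloch_function_diff:
  assumes "bloch_function f" "bloch_function g"
  shows "bloch_function (\<lambda>z. f z - g z)"
proof -
  have hol: "f holomorphic_on ball 0 1" "g holomorphic_on ball 0 1"
    using assms by (auto simp: bloch_function_def)
  obtain A B where
    A: "\<And>z. z \<in> ball 0 1 \<Longrightarrow> (1 - (cmod z)\<^sup>2) * cmod (deriv f z) \<le> A" and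
    B: "\<And>z. z \<in> ball 0 1 \<Longrightarrow> (1 - (cmod z)\<^sup>2) * cmod (deriv g z) \<le> B"
    using assms unfolding bloch_function_def bdd_above_def by blast
  have "(1 - (cmod z)\<^sup>2) * cmod (deriv (\<lambda>z. f z - g z) z) \<le> A + B" if z: "z \<in> ball 0 1" for z
  proof -
    have "deriv (\<lambda>z. f z - g z) z = deriv f z - deriv g z"
      using hol z by (intro deriv_diff) (auto intro: holomorphic_on_imp_differentiable_at)
    then have "cmod (deriv (\<lambda>z. f z - g z) z) \<le> cmod (deriv f z) + cmod (deriv g z)"
      by (simp add: norm_triangle_ineq4)
    moreover have "0 \<le> 1 - (cmod z)\<^sup>2"
      using z by (simp add: power_le_one)
    ultimately have "(1 - (cmod z)\<^sup>2) * cmod (deriv (\<lambda>z. f z - g z) z)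
        \<le> (1 - (cmod z)\<^sup>2) * (cmod (deriv f z) + cmod (deriv g z))"
      by (rule mult_left_mono)
    then show ?thesis
      using A[OF z] B[OF z] by (simp add: distrib_left)
  qed
  then show ?thesis
    using hol unfolding bloch_function_def
    by (auto intro!: holomorphic_intros bdd_aboveI2)
qed

lemma bloch_seminorm_upper:
  assumes "bloch_function f" "z \<in> ball 0 1"
  shows "(1 - (cmod z)\<^sup>2) * cmod (deriv f z) \<le> bloch_seminorm f"
  using assms unfolding bloch_function_def bloch_seminorm_def by (auto intro: cSUP_upper)

lemma bloch_seminorm_nonneg: "bloch_function f \<Longrightarrow> 0 \<le> bloch_seminorm f"
  using bloch_seminorm_upper[of f 0] order_trans[OF norm_ge_zero[of "deriv f 0"]] by simp

lemma bloch_norm_nonneg: "bloch_function f \<Longrightarrow> 0 \<le> bloch_norm f"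
  by (simp add: bloch_norm_def bloch_seminorm_nonneg)

lemma bloch_norm_triangle:
  assumes f: "bloch_function f" and g: "bloch_function g" and h: "bloch_function h"
  shows "bloch_norm (\<lambda>z. f z - h z) \<le> bloch_norm (\<lambda>z. f z - g z) + bloch_norm (\<lambda>z. g z - h z)"
proof -
  have hol: "f holomorphic_on ball 0 1" "g holomorphic_on ball 0 1" "h holomorphic_on ball 0 1"
    using assms by (auto simp: bloch_function_def)
  have "bloch_seminorm (\<lambda>z. f z - h z)
      \<le> bloch_seminorm (\<lambda>z. f z - g z) + bloch_seminorm (\<lambda>z. g z - h z)"
    unfolding bloch_seminorm_def[of "\<lambda>z. f z - h z"]
  proof (rule cSUP_least)
    fix z :: complex assume z: "z \<in> ball 0 1"
    have d: "f field_differentiable at z" "g field_differentiable at z" "h field_differentiable at z"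
      using hol z by (auto intro: holomorphic_on_imp_differentiable_at)
    have "cmod (deriv (\<lambda>z. f z - h z) z)
        \<le> cmod (deriv (\<lambda>z. f z - g z) z) + cmod (deriv (\<lambda>z. g z - h z) z)"
      using d norm_triangle_ineq[of "deriv f z - deriv g z" "deriv g z - deriv h z"] by simp
    moreover have "0 \<le> 1 - (cmod z)\<^sup>2"
      using z by (simp add: power_le_one)
    ultimately have "(1 - (cmod z)\<^sup>2) * cmod (deriv (\<lambda>z. f z - h z) z)
        \<le> (1 - (cmod z)\<^sup>2) * (cmod (deriv (\<lambda>z. f z - g z) z) + cmod (deriv (\<lambda>z. g z - h z) z))"
      by (rule mult_left_mono)
    then show "(1 - (cmod z)\<^sup>2) * cmod (deriv (\<lambda>z. f z - h z) z)
        \<le> bloch_seminorm (\<lambda>z. f z - g z) + bloch_seminorm (\<lambda>z. g z - h z)"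
      using bloch_seminorm_upper[OF bloch_function_diff[OF f g] z]
        bloch_seminorm_upper[OF bloch_function_diff[OF g h] z]
      by (simp add: distrib_left)
  qed simp
  moreover have "cmod (f 0 - h 0) \<le> cmod (f 0 - g 0) + cmod (g 0 - h 0)"
    using norm_triangle_ineq[of "f 0 - g 0" "g 0 - h 0"] by simp
  ultimately show ?thesis
    by (simp add: bloch_norm_def)
qed

lemma bloch_norm_eq_0:
  assumes f: "bloch_function f" and "bloch_norm f = 0" and z: "z \<in> ball 0 1"
  shows "f z = 0"
proof -
  have 0: "f 0 = 0" "bloch_seminorm f = 0"
    using assms(2) bloch_seminorm_nonneg[OF f] norm_ge_zero[of "f 0"]
    by (auto simp: bloch_norm_def add_nonneg_eq_0_iff)
  have hol: "f holomorphic_on ball 0 1"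
    using f by (simp add: bloch_function_def)
  have "(f has_field_derivative 0) (at w within ball 0 1)" if w: "w \<in> ball 0 1" for w
  proof -
    have "0 < 1 - (cmod w)\<^sup>2"
      using w by (simp add: power_less_one_iff abs_square_less_1)
    then have "deriv f w = 0"
      using bloch_seminorm_upper[OF f w] 0(2) by (simp add: mult_le_0_iff)
    then show ?thesis
      using holomorphic_derivI[OF hol open_ball w] by (simp add: has_field_derivative_at_within)
  qed
  then obtain c where "\<forall>x\<in>ball 0 1. f x = c"
    using has_field_derivative_zero_constant[OF convex_ball] by blast
  then show ?thesis
    using 0(1) z by (metis centre_in_ball zero_less_one)
qed

lemma bloch_norm_diff_commute:
  assumes "bloch_function f" "bloch_function g"
  shows "bloch_norm (\<lambda>z. f z - g z) = bloch_norm (\<lambda>z. g z - f z)"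
proof -
  have "cmod (deriv (\<lambda>z. f z - g z) z) = cmod (deriv (\<lambda>z. g z - f z) z)" if "z \<in> ball 0 1" for z
    using assms that unfolding bloch_function_def
    by (subst deriv_diff deriv_diff, (auto intro: holomorphic_on_imp_differentiable_at)[2])+
      (simp add: norm_minus_commute)
  then have "bloch_seminorm (\<lambda>z. f z - g z) = bloch_seminorm (\<lambda>z. g z - f z)"
    unfolding bloch_seminorm_def by (intro arg_cong[where f = Sup] image_cong refl) metis
  then show ?thesis
    by (simp add: bloch_norm_def norm_minus_commute)
qed

lemma bloch_function_zero: "bloch_function (\<lambda>z. 0)"
  by (auto simp: bloch_function_def intro!: bdd_aboveI2)

lemma bloch_norm_zero: "bloch_norm (\<lambda>z. 0) = 0"
  by (simp add: bloch_norm_def bloch_seminorm_def)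

interpretation bloch: Metric_space bloch_space bloch_dist
proof
  fix f g h
  show "0 \<le> bloch_dist f g"
    by (simp add: bloch_dist_def bloch_space_def bloch_function_diff bloch_norm_nonneg)
  show "bloch_dist f g = bloch_dist g f"
    by (auto simp: bloch_dist_def bloch_space_def intro: bloch_norm_diff_commute)
  show "bloch_dist f g = 0 \<longleftrightarrow> f = g" if fg: "f \<in> bloch_space" "g \<in> bloch_space"
  proof
    assume "bloch_dist f g = 0"
    then have "f z - g z = 0" if "z \<in> ball 0 1" for z
      using fg that bloch_norm_eq_0[OF bloch_function_diff]
      by (simp add: bloch_dist_def bloch_space_def)
    moreover have "f z - g z = 0" if "z \<notin> ball 0 1" for z
      using fg that unfolding bloch_space_def by simp
    ultimately have "f z - g z = 0" for z
      by (cases "z \<in> ball 0 1") blast+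
    then show "f = g"
      by (intro ext) simp
  qed (simp add: bloch_dist_def bloch_norm_zero)
  show "bloch_dist f h \<le> bloch_dist f g + bloch_dist g h"
    if "f \<in> bloch_space" "g \<in> bloch_space" "h \<in> bloch_space"
    using that by (simp add: bloch_dist_def bloch_space_def bloch_norm_triangle)
qed

lemma bloch_function_bounded:
  assumes hol: "f holomorphic_on ball 0 1" and M: "\<And>z. z \<in> ball 0 1 \<Longrightarrow> cmod (f z) \<le> M"
  shows "bloch_function f"
proof -
  have M0: "0 \<le> M"
    using order_trans[OF norm_ge_zero M[of 0]] by simp
  have "(1 - (cmod z)\<^sup>2) * cmod (deriv f z) \<le> 4 * M" if z: "z \<in> ball 0 1" for z
  proof -
    define r where "r = (1 - cmod z) / 2"
    have r: "0 < r" and r2: "1 - cmod z = 2 * r"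
      using z by (auto simp: r_def)
    have sub: "cball z r \<subseteq> ball 0 1"
    proof
      fix w assume "w \<in> cball z r"
      then have "cmod (w - z) \<le> r"
        by (simp add: dist_norm norm_minus_commute)
      then show "w \<in> ball 0 1"
        using norm_triangle_sub[of w z] r r2 by simp
    qed
    have "cmod ((deriv ^^ 1) f z) \<le> fact 1 * M / r ^ 1"
    proof (rule Cauchy_inequality)
      show "f holomorphic_on ball z r"
        using hol sub ball_subset_cball holomorphic_on_subset by blast
      show "continuous_on (cball z r) f"
        using hol sub holomorphic_on_imp_continuous_on continuous_on_subset by blast
      show "cmod (f x) \<le> M" if "cmod (z - x) = r" for x
        using M sub that by (auto simp: dist_norm subset_iff)
    qed (fact r)
    then have "r * cmod (deriv f z) \<le> M"
      using r by (simp add: field_simps)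
    moreover have "1 - (cmod z)\<^sup>2 = 2 * (1 + cmod z) * r"
      by (simp add: r_def power2_eq_square field_simps)
    ultimately have "(1 - (cmod z)\<^sup>2) * cmod (deriv f z) \<le> (2 * (1 + cmod z)) * M"
      by (simp add: mult.assoc mult_left_mono)
    also have "\<dots> \<le> 4 * M"
      using z M0 by (intro mult_right_mono) auto
    finally show ?thesis .
  qed
  then show ?thesis
    using hol unfolding bloch_function_def by (auto intro!: bdd_aboveI2)
qed

definition linear_on_bloch ::
    "((complex \<Rightarrow> complex) \<Rightarrow> complex \<Rightarrow> complex) \<Rightarrow> bool" where
  "linear_on_bloch T \<longleftrightarrow> (\<forall>f\<in>bloch_space. \<forall>g\<in>bloch_space. \<forall>a b.
     T (\<lambda>z. a * f z + b * g z) = (\<lambda>z. a * T f z + b * T g z))"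

definition compact_on_bloch ::
    "((complex \<Rightarrow> complex) \<Rightarrow> complex \<Rightarrow> complex) \<Rightarrow> bool" where
  "compact_on_bloch T \<longleftrightarrow> linear_on_bloch T \<and> T ` bloch_space \<subseteq> bloch_space \<and>
     compactin bloch.mtopology
       (bloch.mtopology closure_of (T ` {f \<in> bloch_space. bloch_norm f \<le> 1}))"

end

theory Submission
  imports Defs
begin

text \<open>
  Write \<open>T f = \<Sum>i. c i * f \<circ> \<phi> i\<close>, so that \<open>T (z ^ n)\<close> is the combination of powers in the criterion.

  If \<open>T\<close> is compact, then the functions \<open>T (z ^ n)\<close> lie, up to a constant factor, in a compact set,
  because the powers are bounded in the Bloch space. They tend to \<open>0\<close> pointwise and convergence in
  the Bloch norm implies pointwise convergence, so \<open>0\<close> is their only cluster point.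

  The converse is an interpolation argument. At a point \<open>w\<close> the derivative of \<open>T f\<close> depends
  only on the values of \<open>f'\<close> at the at most \<open>k\<close> points \<open>\<phi> i w\<close>. Suppose that at these points
  \<open>f'\<close> agrees with the derivative of \<open>\<Sum>n. b n * z ^ Suc n\<close>, where \<open>\<Sum>n. \<bar>b n\<bar>\<close> is at most a constant
  times the Bloch seminorm of \<open>f\<close>. Then \<open>(T f)' w = \<Sum>n. b n * (T (z ^ Suc n))' w\<close>, and
  \<open>(1 - \<bar>w\<bar>\<^sup>2) * \<bar>(T f)' w\<bar>\<close> is at most \<open>\<Sum>n. \<bar>b n\<bar> * E (Suc n)\<close> with \<open>E n\<close> the seminorm of \<open>T (z ^ n)\<close>.
  The point is that such a \<open>b\<close> exists with a constant that depends on the number of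
  points only, not on their position (lemma \<open>bloch_interpolation\<close>).

  To find \<open>b\<close>, interpolate one point \<open>a\<close> at a time: subtract from \<open>f'\<close> the multiple
  \<open>\<beta> * (1 - \<bar>a\<bar>\<^sup>2) / (1 - cnj a * z)\<^sup>2\<close> of a kernel that has the same value at \<open>a\<close>, and divide the
  difference by the Moebius factor \<open>(z - a) / (1 - cnj a * z)\<close>. By the maximum principle the quotient
  satisfies the same growth bound up to a constant, so the induction hypothesis applies
  to it. Both the kernel and multiplication by the Moebius factor act boundedly on
  the coefficients, since the Taylor coefficients of the factor have absolute sum at most \<open>3\<close>.

  The same construction bounds every single \<open>\<bar>b n\<bar>\<close> by a constant times
  \<open>\<mu> = sup (1 - \<bar>z\<bar>\<^sup>2)\<^sup>2 * \<bar>f' z\<bar>\<close>. If a bounded sequence of Bloch functions tends to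
  \<open>0\<close> at the origin and has derivatives tending to \<open>0\<close> uniformly on compact sets, then \<open>\<mu>\<close> tends to
  \<open>0\<close> along the sequence. In \<open>\<Sum>n. \<bar>b n\<bar> * E (Suc n)\<close> the terms with small \<open>n\<close> are then small because
  \<open>\<mu>\<close> is, and the others because \<open>E n\<close> tends to \<open>0\<close>; hence \<open>T\<close> maps the sequence to a null sequence
  (lemma \<open>comb_tendsto_0\<close>). By Montel's theorem every sequence in the unit ball has a subsequence
  whose differences from some element of the ball form such a sequence, which gives compactness.
\<close>

section \<open>Division by a Moebius factor\<close>

lemma one_minus_cnj_mult_nonzero:
  fixes a z :: complex
  assumes "cmod a < 1" "cmod z < 1"
  shows "1 - cnj a * z \<noteq> 0"
proof
  assume "1 - cnj a * z = 0"
  then have "cmod a * cmod z = 1"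
    by (metis complex_mod_cnj eq_iff_diff_eq_0 norm_mult norm_one)
  moreover have "cmod a * cmod z < 1"
    using assms mult_strict_mono'[of "cmod a" 1 "cmod z" 1] by simp
  ultimately show False by simp
qed

lemma moebius_identity:
  fixes a z :: complex
  shows "(cmod (1 - cnj a * z))\<^sup>2 - (cmod (z - a))\<^sup>2 = (1 - (cmod a)\<^sup>2) * (1 - (cmod z)\<^sup>2)"
  by (simp add: cmod_power2 algebra_simps) (simp add: power2_eq_square algebra_simps)

text \<open>
  Dividing by \<open>(z - a) / (1 - cnj a * z)\<close> preserves a growth bound with weight
  \<open>(1 - \<bar>z\<bar>\<^sup>2) ^ s\<close> up to a factor that does not depend on \<open>a\<close>. Where the Moebius factor is at least
  \<open>1/2\<close> in modulus this is immediate. The remaining points form a pseudohyperbolic disk,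
  on which \<open>1 - \<bar>z\<bar>\<^sup>2\<close> is comparable with \<open>\<bar>1 - cnj a * z\<bar>\<^sup>2 / (1 - \<bar>a\<bar>\<^sup>2)\<close>, the modulus of a holomorphic
  function, so that the maximum principle applies to the weighted quotient.
\<close>

lemma moebius_quotient_bound:
  fixes G :: "complex \<Rightarrow> complex"
  assumes a: "cmod a < 1" and G: "G holomorphic_on ball 0 1"
    and M: "\<And>z. cmod z < 1 \<Longrightarrow>
      (1 - (cmod z)\<^sup>2) ^ s * cmod ((z - a) / (1 - cnj a * z) * G z) \<le> M"
    and z: "cmod z < 1"
  shows "(1 - (cmod z)\<^sup>2) ^ s * cmod (G z) \<le> 2 * (4/3) ^ s * M"
proof -
  define P where "P = 1 - (cmod a)\<^sup>2"
  define S where "S = {z. 2 * cmod (z - a) \<le> cmod (1 - cnj a * z)}"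
  define F where "F = (\<lambda>z. G z * (1 - cnj a * z) ^ (2 * s) / of_real (P ^ s))"
  have P: "P > 0"
    using a by (simp add: P_def power_less_one_iff abs_square_less_1)
  have "0 \<le> cmod ((0 - a) / (1 - cnj a * 0) * G 0)"
    by (rule norm_ge_zero)
  also have "\<dots> \<le> M"
    using M[of 0] by simp
  finally have M0: "0 \<le> M" .
  have wt: "0 \<le> (1 - (cmod w)\<^sup>2) ^ s" if "cmod w < 1" for w
    using that by (simp add: power_le_one)
  have comparable: "cmod w < 1" "3/4 * (cmod (1 - cnj a * w))\<^sup>2 \<le> P * (1 - (cmod w)\<^sup>2)"
    "P * (1 - (cmod w)\<^sup>2) \<le> (cmod (1 - cnj a * w))\<^sup>2" if w: "w \<in> S" for w
  proof -
    have "(2 * cmod (w - a))\<^sup>2 \<le> (cmod (1 - cnj a * w))\<^sup>2"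
      using w by (intro power_mono) (auto simp: S_def)
    then show b: "3/4 * (cmod (1 - cnj a * w))\<^sup>2 \<le> P * (1 - (cmod w)\<^sup>2)"
      using moebius_identity[of a w] by (simp add: P_def power_mult_distrib)
    show "P * (1 - (cmod w)\<^sup>2) \<le> (cmod (1 - cnj a * w))\<^sup>2"
      using moebius_identity[of a w] zero_le_power2[of "cmod (w - a)"]
      unfolding P_def by linarith
    have "1 - cnj a * w \<noteq> 0"
    proof
      assume 0: "1 - cnj a * w = 0"
      then have "w = a"
        using w by (simp add: S_def)
      then show False
        using 0 one_minus_cnj_mult_nonzero[OF a a] by simp
    qed
    then have "0 < P * (1 - (cmod w)\<^sup>2)"
      by (intro less_le_trans[OF _ b]) simp
    then show "cmod w < 1"
      using P by (simp add: zero_less_mult_iff abs_square_less_1)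
  qed
  \<comment> \<open>On \<open>S\<close> the modulus of \<open>F\<close> is comparable with the weighted modulus of \<open>G\<close>.\<close>
  have normF: "cmod (F w) = cmod (G w) * ((cmod (1 - cnj a * w))\<^sup>2 / P) ^ s" for w
    using P by (simp add: F_def norm_mult norm_divide norm_power power_mult power_divide)
  have closed: "closed S"
    unfolding S_def by (intro closed_Collect_le continuous_intros)
  have inside: "{z. 2 * cmod (z - a) < cmod (1 - cnj a * z)} \<subseteq> interior S"
    by (intro interior_maximal open_Collect_less continuous_intros) (auto simp: S_def)
  have bound: "cmod (F w) \<le> 2 * (4/3) ^ s * M" if w: "w \<in> frontier S" for w
  proof -
    have wS: "w \<in> S" and "w \<notin> interior S"
      using w closed by (auto simp: frontier_def)
    then have "\<not> 2 * cmod (w - a) < cmod (1 - cnj a * w)"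
      using inside by blast
    then have eq: "2 * cmod (w - a) = cmod (1 - cnj a * w)"
      using wS by (simp add: S_def)
    note c = comparable[OF wS]
    have "1 - cnj a * w \<noteq> 0"
      using a c(1) by (rule one_minus_cnj_mult_nonzero)
    then have half: "cmod ((w - a) / (1 - cnj a * w)) = 1/2"
      using eq by (simp add: norm_divide divide_eq_eq)
    have "(cmod (1 - cnj a * w))\<^sup>2 / P \<le> 4/3 * (1 - (cmod w)\<^sup>2)"
      using c(2) P by (simp add: field_simps)
    then have "((cmod (1 - cnj a * w))\<^sup>2 / P) ^ s \<le> (4/3 * (1 - (cmod w)\<^sup>2)) ^ s"
      using P by (intro power_mono) auto
    then have "cmod (F w) \<le> cmod (G w) * (4/3 * (1 - (cmod w)\<^sup>2)) ^ s"
      unfolding normF by (intro mult_left_mono) auto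
    also have "\<dots> = (4/3) ^ s * (2 * ((1 - (cmod w)\<^sup>2) ^ s * cmod ((w - a) / (1 - cnj a * w) * G w)))"
      by (simp only: norm_mult half power_mult_distrib) simp
    also have "\<dots> \<le> (4/3) ^ s * (2 * M)"
      using M[OF c(1)] by (intro mult_left_mono) auto
    finally show ?thesis by (simp add: mult_ac)
  qed
  show ?thesis
  proof (cases "z \<in> S")
    case True
    have sub: "S \<subseteq> ball 0 1"
      using comparable(1) by auto
    have holF: "F holomorphic_on ball 0 1"
      unfolding F_def using P by (intro holomorphic_intros G) auto
    have "cmod (F z) \<le> 2 * (4/3) ^ s * M"
    proof (rule maximum_modulus_frontier[OF _ _ _ bound True])
      show "F holomorphic_on interior S"
        using holF holomorphic_on_subset interior_subset sub by blast
      show "continuous_on (closure S) F"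
        using holF holomorphic_on_imp_continuous_on closed sub continuous_on_subset by fastforce
      show "bounded S"
        using sub bounded_ball bounded_subset by blast
    qed
    moreover have "(1 - (cmod z)\<^sup>2) ^ s \<le> ((cmod (1 - cnj a * z))\<^sup>2 / P) ^ s"
      using comparable(3)[OF True] P z by (intro power_mono) (auto simp: field_simps power_le_one)
    then have "(1 - (cmod z)\<^sup>2) ^ s * cmod (G z) \<le> cmod (F z)"
      unfolding normF by (simp add: mult.commute mult_left_mono)
    ultimately show ?thesis by simp
  next
    case False
    have nz: "1 - cnj a * z \<noteq> 0"
      using a z by (rule one_minus_cnj_mult_nonzero)
    then have "1/2 \<le> cmod ((z - a) / (1 - cnj a * z))"
      using False by (simp add: S_def norm_divide field_simps)
    then have "(1 - (cmod z)\<^sup>2) ^ s * (1/2 * cmod (G z)) \<le> M"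
      using M[OF z] wt[OF z] unfolding norm_mult
      by (meson mult_left_mono mult_right_mono norm_ge_zero order_trans)
    then have "(1 - (cmod z)\<^sup>2) ^ s * cmod (G z) \<le> 2 * M" by simp
    also have "\<dots> \<le> (4/3) ^ s * (2 * M)"
      using M0 by (simp add: mult_le_cancel_right1)
    finally show ?thesis by (simp add: mult_ac)
  qed
qed

section \<open>Interpolation by series with absolutely summable coefficients\<close>

lemma moebius_coefficients:
  fixes a :: complex
  assumes a: "cmod a < 1"
  obtains p where "summable (\<lambda>n. cmod (p n))" "(\<Sum>n. cmod (p n)) \<le> 3"
    "\<And>z. cmod z < 1 \<Longrightarrow> (\<lambda>n. p n * z ^ n) sums ((z - a) / (1 - cnj a * z))"
proof -
  define P where "P = 1 - (cmod a)\<^sup>2"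
  have P: "P \<ge> 0"
    using a by (simp add: P_def power_le_one)
  define p where "p = (\<lambda>n. if n = 0 then - a else of_real P * cnj a ^ (n - 1))"
  have p: "p 0 = - a" "\<And>n. p (Suc n) = of_real P * cnj a ^ n"
    by (simp_all add: p_def)
  have Suc: "cmod (p (Suc n)) = P * cmod a ^ n" for n
    using P by (simp add: p norm_mult norm_power)
  have "(\<lambda>n. cmod (p (Suc n))) sums (P * (1 / (1 - cmod a)))"
    unfolding Suc using a by (intro sums_mult geometric_sums) simp
  moreover have "P * (1 / (1 - cmod a)) = 1 + cmod a"
    using a by (simp add: P_def divide_simps) (simp add: power2_eq_square algebra_simps)
  ultimately have "(\<lambda>n. cmod (p (Suc n))) sums (1 + cmod a)" by simp
  then have s: "(\<lambda>n. cmod (p n)) sums (1 + cmod a + cmod a)"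
    by (subst (asm) sums_Suc_iff) (simp add: p)
  have bound: "(\<Sum>n. cmod (p n)) \<le> 3"
    using sums_unique[OF s] a by simp
  have "(\<lambda>n. p n * z ^ n) sums ((z - a) / (1 - cnj a * z))" if z: "cmod z < 1" for z
  proof -
    have nz: "1 - cnj a * z \<noteq> 0"
      using a z by (rule one_minus_cnj_mult_nonzero)
    have "cmod (cnj a * z) < 1"
      using a z mult_strict_mono'[of "cmod a" 1 "cmod z" 1] by (simp add: norm_mult)
    then have "(\<lambda>n. of_real P * z * (cnj a * z) ^ n) sums (of_real P * z * (1 / (1 - cnj a * z)))"
      by (intro sums_mult geometric_sums)
    moreover have "p (Suc n) * z ^ Suc n = of_real P * z * (cnj a * z) ^ n" for n
      by (simp add: p power_mult_distrib)
    ultimately have "(\<lambda>n. p (Suc n) * z ^ Suc n) sums (of_real P * z * (1 / (1 - cnj a * z)))"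
      by (simp only:)
    then have "(\<lambda>n. p n * z ^ n) sums (of_real P * z * (1 / (1 - cnj a * z)) - a)"
      by (subst (asm) sums_Suc_iff) (simp add: p)
    moreover have "of_real P * z * (1 / (1 - cnj a * z)) - a = (z - a) / (1 - cnj a * z)"
      using nz complex_norm_square[of a] by (simp add: P_def divide_simps) (simp add: algebra_simps)
    ultimately show ?thesis by simp
  qed
  with sums_summable[OF s] bound show thesis
    by (rule that)
qed

text \<open>
  The kernel \<open>(1 - \<bar>a\<bar>\<^sup>2) / (1 - cnj a * z)\<^sup>2\<close> takes the value \<open>1 / (1 - \<bar>a\<bar>\<^sup>2)\<close> at \<open>a\<close>, so
  \<open>\<beta> = (1 - \<bar>a\<bar>\<^sup>2) * g a\<close> makes the difference vanish there.
\<close>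

lemma bloch_interpolation_step:
  fixes g :: "complex \<Rightarrow> complex"
  assumes a: "cmod a < 1" and g: "g holomorphic_on ball 0 1"
    and M: "\<And>z. cmod z < 1 \<Longrightarrow> (1 - (cmod z)\<^sup>2) * cmod (g z) \<le> M"
    and \<mu>: "\<And>z. cmod z < 1 \<Longrightarrow> (1 - (cmod z)\<^sup>2)\<^sup>2 * cmod (g z) \<le> \<mu>"
  defines "P \<equiv> 1 - (cmod a)\<^sup>2"
  obtains \<beta> G where "cmod \<beta> \<le> M" "cmod \<beta> * P \<le> \<mu>" "G holomorphic_on ball 0 1"
    "\<And>z. cmod z < 1 \<Longrightarrow> (1 - (cmod z)\<^sup>2) * cmod (G z) \<le> 18 * M"
    "\<And>z. cmod z < 1 \<Longrightarrow> (1 - (cmod z)\<^sup>2)\<^sup>2 * cmod (G z) \<le> 18 * \<mu>"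
    "\<And>z. cmod z < 1 \<Longrightarrow>
      g z = \<beta> * (of_real P / (1 - cnj a * z)\<^sup>2) + (z - a) / (1 - cnj a * z) * G z"
proof -
  define \<beta> where "\<beta> = of_real P * g a"
  define K where "K = (\<lambda>z. of_real P / (1 - cnj a * z)\<^sup>2)"
  define g1 where "g1 = (\<lambda>z. g z - \<beta> * K z)"
  define G where "G = (\<lambda>z. (1 - cnj a * z) *
    (if z = a then deriv g1 a else (g1 z - g1 a) / (z - a)))"
  have P: "P > 0"
    using a by (simp add: P_def abs_square_less_1)
  have M0: "0 \<le> M"
    using M[of 0] order_trans[OF norm_ge_zero[of "g 0"]] by simp
  have nz: "1 - cnj a * z \<noteq> 0" if "cmod z < 1" for z
    using a that by (rule one_minus_cnj_mult_nonzero)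
  have norm\<beta>: "cmod \<beta> = P * cmod (g a)"
    using P by (simp add: \<beta>_def norm_mult)
  have \<beta>M: "cmod \<beta> \<le> M"
    using M[OF a] unfolding norm\<beta> P_def .
  have \<beta>\<mu>: "cmod \<beta> * P \<le> \<mu>"
    using \<mu>[OF a] unfolding norm\<beta> P_def by (simp add: power2_eq_square mult_ac)
  have normK: "cmod (K z) = P / (cmod (1 - cnj a * z))\<^sup>2" for z
    using P by (simp add: K_def norm_divide norm_power)
  have K: "K holomorphic_on ball 0 1"
    unfolding K_def using nz by (intro holomorphic_intros) auto
  have g1: "g1 holomorphic_on ball 0 1"
    unfolding g1_def by (intro holomorphic_intros g K)
  have "1 - cnj a * a = of_real P"
    using complex_norm_square[of a] by (simp add: P_def mult.commute)
  then have g1a: "g1 a = 0"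
    using P by (simp add: g1_def \<beta>_def K_def power2_eq_square)
  have G: "G holomorphic_on ball 0 1"
    unfolding G_def by (intro holomorphic_intros pole_lemma_open g1 open_ball)
  have eq: "g1 z = (z - a) / (1 - cnj a * z) * G z" if "cmod z < 1" for z
    using nz[OF that] g1a by (simp add: G_def)
  have K1: "(1 - (cmod z)\<^sup>2) * cmod (K z) \<le> 1" if z: "cmod z < 1" for z
  proof -
    have "P * (1 - (cmod z)\<^sup>2) \<le> (cmod (1 - cnj a * z))\<^sup>2"
      using moebius_identity[of a z] zero_le_power2[of "cmod (z - a)"]
      unfolding P_def by linarith
    then show ?thesis
      using nz[OF z] by (simp add: normK field_simps)
  qed
  have K2: "(1 - (cmod z)\<^sup>2)\<^sup>2 * cmod (K z) \<le> 4 * P" if z: "cmod z < 1" for z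
  proof -
    have "cmod (cnj a * z) \<le> cmod z"
      using a by (simp add: norm_mult mult_left_le_one_le)
    then have "2 * (1 - cmod z) \<le> 2 * cmod (1 - cnj a * z)"
      using norm_triangle_ineq2[of 1 "cnj a * z"] by simp
    moreover have "(1 + cmod z) * (1 - cmod z) \<le> 2 * (1 - cmod z)"
      using z by (intro mult_right_mono) auto
    then have "1 - (cmod z)\<^sup>2 \<le> 2 * (1 - cmod z)"
      by (simp add: power2_eq_square algebra_simps)
    ultimately have "1 - (cmod z)\<^sup>2 \<le> 2 * cmod (1 - cnj a * z)"
      by (rule order_trans[rotated])
    then have "(1 - (cmod z)\<^sup>2)\<^sup>2 \<le> (2 * cmod (1 - cnj a * z))\<^sup>2"
      using z by (intro power_mono) (auto simp: power_le_one)
    then have "P * (1 - (cmod z)\<^sup>2)\<^sup>2 \<le> P * (4 * (cmod (1 - cnj a * z))\<^sup>2)"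
      using P by (intro mult_left_mono) (auto simp: power_mult_distrib)
    then show ?thesis
      using nz[OF z] by (simp add: normK field_simps)
  qed
  have wt: "0 \<le> 1 - (cmod z)\<^sup>2" if "cmod z < 1" for z
    using that by (simp add: power_le_one)
  have g1M: "(1 - (cmod z)\<^sup>2) * cmod (g1 z) \<le> 2 * M" if z: "cmod z < 1" for z
  proof -
    have "(1 - (cmod z)\<^sup>2) * cmod (g1 z)
        \<le> (1 - (cmod z)\<^sup>2) * (cmod (g z) + cmod \<beta> * cmod (K z))"
      unfolding g1_def using wt[OF z] norm_triangle_ineq4[of "g z" "\<beta> * K z"]
      by (intro mult_left_mono) (auto simp: norm_mult)
    also have "\<dots> = (1 - (cmod z)\<^sup>2) * cmod (g z) + cmod \<beta> * ((1 - (cmod z)\<^sup>2) * cmod (K z))"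
      by (simp add: algebra_simps)
    also have "\<dots> \<le> M + M * 1"
      using M[OF z] K1[OF z] \<beta>M M0 wt[OF z] by (intro add_mono mult_mono) auto
    finally show ?thesis by simp
  qed
  have g1\<mu>: "(1 - (cmod z)\<^sup>2)\<^sup>2 * cmod (g1 z) \<le> 5 * \<mu>" if z: "cmod z < 1" for z
  proof -
    have "(1 - (cmod z)\<^sup>2)\<^sup>2 * cmod (g1 z)
        \<le> (1 - (cmod z)\<^sup>2)\<^sup>2 * (cmod (g z) + cmod \<beta> * cmod (K z))"
      unfolding g1_def using norm_triangle_ineq4[of "g z" "\<beta> * K z"]
      by (intro mult_left_mono) (auto simp: norm_mult)
    also have "\<dots> = (1 - (cmod z)\<^sup>2)\<^sup>2 * cmod (g z) + cmod \<beta> * ((1 - (cmod z)\<^sup>2)\<^sup>2 * cmod (K z))"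
      by (simp add: algebra_simps)
    also have "\<dots> \<le> \<mu> + cmod \<beta> * (4 * P)"
      using \<mu>[OF z] K2[OF z] by (intro add_mono mult_left_mono) auto
    finally show ?thesis
      using \<beta>\<mu> by simp
  qed
  have GM: "(1 - (cmod z)\<^sup>2) * cmod (G z) \<le> 18 * M" if z: "cmod z < 1" for z
    using moebius_quotient_bound[OF a G, of 1 "2 * M" z] g1M z M0 by (simp add: eq)
  have G\<mu>: "(1 - (cmod z)\<^sup>2)\<^sup>2 * cmod (G z) \<le> 18 * \<mu>" if z: "cmod z < 1" for z
  proof -
    have "0 \<le> \<mu>"
      using P \<beta>\<mu> by (meson mult_nonneg_nonneg norm_ge_zero order.trans less_imp_le)
    then show ?thesis
      using moebius_quotient_bound[OF a G, of 2 "5 * \<mu>" z] g1\<mu> z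
      by (simp add: eq power2_eq_square[of "4/3"])
  qed
  have "g z = \<beta> * (of_real P / (1 - cnj a * z)\<^sup>2) + (z - a) / (1 - cnj a * z) * G z"
    if "cmod z < 1" for z
    using eq[OF that] by (simp add: g1_def K_def algebra_simps)
  with \<beta>M \<beta>\<mu> G GM G\<mu> show thesis
    by (rule that)
qed

text \<open>
  The interpolating series is the derivative of \<open>\<Sum>n. b n * z ^ Suc n\<close>. The two bounds on \<open>b\<close> serve
  different ends: the first is a bound by the Bloch seminorm, the second by a quantity that is small
  when \<open>g\<close> is small on a large compact subset of the disk.
\<close>

lemma bloch_interpolation:
  fixes g :: "complex \<Rightarrow> complex"
  assumes S: "finite S" "S \<subseteq> ball 0 1" and g: "g holomorphic_on ball 0 1"
    and M: "\<And>z. cmod z < 1 \<Longrightarrow> (1 - (cmod z)\<^sup>2) * cmod (g z) \<le> M"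
    and \<mu>: "\<And>z. cmod z < 1 \<Longrightarrow> (1 - (cmod z)\<^sup>2)\<^sup>2 * cmod (g z) \<le> \<mu>"
  shows "\<exists>b :: nat \<Rightarrow> complex. summable (\<lambda>n. cmod (b n)) \<and>
    (\<Sum>n. cmod (b n)) \<le> 56 ^ card S * M \<and> (\<forall>n. cmod (b n) \<le> 56 ^ card S * \<mu>) \<and>
    (\<forall>z\<in>S. (\<lambda>n. of_nat (Suc n) * b n * z ^ n) sums g z)"
  using S g M \<mu>
proof (induction S arbitrary: g M \<mu> rule: finite_induct)
  case empty
  have "0 \<le> M" "0 \<le> \<mu>"
    using empty.prems(3,4)[of 0] order_trans[OF norm_ge_zero[of "g 0"]] by auto
  then show ?case
    by (intro exI[of _ "\<lambda>n. 0"]) auto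
next
  case (insert a S)
  define P where "P = 1 - (cmod a)\<^sup>2"
  have a: "cmod a < 1"
    using insert.prems(1) by simp
  have P: "P > 0"
    using a by (simp add: P_def abs_square_less_1)
  have M0: "0 \<le> M"
    using insert.prems(3)[of 0] order_trans[OF norm_ge_zero[of "g 0"]] by simp
  have \<mu>0: "0 \<le> \<mu>"
    using insert.prems(4)[of 0] order_trans[OF norm_ge_zero[of "g 0"]] by simp
  define C :: real where "C = 56 ^ card S"
  have C: "1 \<le> C" "56 ^ card (insert a S) = 56 * C"
    using insert.hyps by (auto simp: C_def)
  obtain \<beta> G where \<beta>: "cmod \<beta> \<le> M" "cmod \<beta> * P \<le> \<mu>" and G: "G holomorphic_on ball 0 1"
    "\<And>z. cmod z < 1 \<Longrightarrow> (1 - (cmod z)\<^sup>2) * cmod (G z) \<le> 18 * M"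
    "\<And>z. cmod z < 1 \<Longrightarrow> (1 - (cmod z)\<^sup>2)\<^sup>2 * cmod (G z) \<le> 18 * \<mu>"
    and g: "\<And>z. cmod z < 1 \<Longrightarrow>
      g z = \<beta> * (of_real P / (1 - cnj a * z)\<^sup>2) + (z - a) / (1 - cnj a * z) * G z"
    using bloch_interpolation_step[OF a insert.prems(2-4)] unfolding P_def by metis
  obtain b where b: "summable (\<lambda>n. cmod (b n))" "(\<Sum>n. cmod (b n)) \<le> C * (18 * M)"
    "\<And>n. cmod (b n) \<le> C * (18 * \<mu>)"
    "\<And>z. z \<in> S \<Longrightarrow> (\<lambda>n. of_nat (Suc n) * b n * z ^ n) sums G z"
    using insert.IH[OF _ G] insert.prems(1) unfolding C_def by auto
  obtain p where p: "summable (\<lambda>n. cmod (p n))" "(\<Sum>n. cmod (p n)) \<le> 3"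
    "\<And>z. cmod z < 1 \<Longrightarrow> (\<lambda>n. p n * z ^ n) sums ((z - a) / (1 - cnj a * z))"
    by (rule moebius_coefficients[OF a]) (use that in blast)
  define v where "v = (\<lambda>n. \<Sum>j\<le>n. p j * (of_nat (Suc (n - j)) * b (n - j)))"
  \<comment> \<open>\<open>v n\<close> is the \<open>n\<close>-th coefficient of the Moebius factor times the series for \<open>G\<close>;
    \<open>\<bar>v n\<bar> / (n + 1)\<close> is at most \<open>u n\<close>, because \<open>n - j + 1 \<le> n + 1\<close>.\<close>
  define u where "u = (\<lambda>n. \<Sum>j\<le>n. cmod (p j) * cmod (b (n - j)))"
  define b' where "b' = (\<lambda>n. \<beta> * of_real P * cnj a ^ n + v n / of_nat (Suc n))"
  have u: "u sums ((\<Sum>n. cmod (p n)) * (\<Sum>n. cmod (b n)))"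
    unfolding u_def using p(1) b(1) by (intro Cauchy_product_sums) auto
  have usum: "(\<Sum>n. cmod (p n)) * (\<Sum>n. cmod (b n)) \<le> 3 * (C * (18 * M))"
    using p(1,2) b(1,2) by (intro mult_mono suminf_nonneg) auto
  have v: "cmod (v n / of_nat (Suc n)) \<le> u n" for n
  proof -
    have "cmod (v n) \<le> (\<Sum>j\<le>n. cmod (p j) * (real (Suc n) * cmod (b (n - j))))"
      unfolding v_def
    proof (rule sum_norm_le)
      fix j
      have "real (Suc (n - j)) * cmod (b (n - j)) \<le> real (Suc n) * cmod (b (n - j))"
        by (intro mult_right_mono) auto
      then show "cmod (p j * (of_nat (Suc (n - j)) * b (n - j)))
          \<le> cmod (p j) * (real (Suc n) * cmod (b (n - j)))"
        by (simp add: norm_mult mult_left_mono del: of_nat_Suc)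
    qed
    also have "\<dots> = u n * real (Suc n)"
      by (simp add: u_def sum_distrib_left mult_ac)
    finally show ?thesis
      by (simp add: norm_divide divide_le_eq del: of_nat_Suc)
  qed
  have ubound: "u n \<le> 3 * (C * (18 * \<mu>))" for n
  proof -
    have "u n \<le> (\<Sum>j\<le>n. cmod (p j)) * (C * (18 * \<mu>))"
      unfolding u_def sum_distrib_right using b(3) by (intro sum_mono mult_left_mono) auto
    also have "(\<Sum>j\<le>n. cmod (p j)) \<le> 3"
      using sum_le_suminf[OF p(1), of "{..n}"] p(2) by simp
    finally show ?thesis
      using C(1) \<mu>0 by (simp add: mult_right_mono)
  qed
  have an: "cmod a ^ n \<le> 1" for n
    using a by (simp add: power_le_one)
  have b'le: "cmod (b' n) \<le> cmod \<beta> * P * cmod a ^ n + u n" for n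
  proof -
    have "cmod (\<beta> * of_real P * cnj a ^ n) = cmod \<beta> * P * cmod a ^ n"
      using P by (simp add: norm_mult norm_power)
    then show ?thesis
      using v[of n] norm_triangle_ineq[of "\<beta> * of_real P * cnj a ^ n" "v n / of_nat (Suc n)"]
      unfolding b'_def by linarith
  qed
  have "(\<lambda>n. cmod \<beta> * P * cmod a ^ n) sums (cmod \<beta> * P * (1 / (1 - cmod a)))"
    using a by (intro sums_mult geometric_sums) simp
  moreover have "cmod \<beta> * P * (1 / (1 - cmod a)) = cmod \<beta> * (1 + cmod a)"
    using a by (simp add: P_def divide_simps) (simp add: power2_eq_square algebra_simps)
  ultimately have major: "(\<lambda>n. cmod \<beta> * P * cmod a ^ n + u n) sums
      (cmod \<beta> * (1 + cmod a) + (\<Sum>n. cmod (p n)) * (\<Sum>n. cmod (b n)))"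
    using u by (intro sums_add) simp_all
  have sm: "summable (\<lambda>n. cmod (b' n))"
    by (rule summable_comparison_test'[OF sums_summable[OF major], of 0]) (simp add: b'le)
  have "(\<Sum>n. cmod (b' n)) \<le> cmod \<beta> * (1 + cmod a) + (\<Sum>n. cmod (p n)) * (\<Sum>n. cmod (b n))"
    using suminf_le[OF b'le sm sums_summable[OF major]] sums_unique[OF major] by simp
  also have "cmod \<beta> * (1 + cmod a) \<le> M * 2"
    using a \<beta>(1) M0 by (intro mult_mono) auto
  also have "M * 2 + (\<Sum>n. cmod (p n)) * (\<Sum>n. cmod (b n)) \<le> M * 2 + 3 * (C * (18 * M))"
    using usum by simp
  also have "\<dots> \<le> 56 * C * M"
    using mult_right_mono[OF C(1) M0] by simp
  finally have total: "(\<Sum>n. cmod (b' n)) \<le> 56 * C * M"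
    by simp
  have each: "cmod (b' n) \<le> 56 * C * \<mu>" for n
  proof -
    have "cmod \<beta> * P * cmod a ^ n \<le> \<mu> * 1"
      using \<beta>(2) an \<mu>0 by (intro mult_mono) auto
    then have "cmod (b' n) \<le> \<mu> + 3 * (C * (18 * \<mu>))"
      using b'le[of n] ubound[of n] by simp
    also have "\<dots> \<le> 56 * C * \<mu>"
      using mult_right_mono[OF C(1) \<mu>0] \<mu>0 by simp
    finally show ?thesis .
  qed
  have interp: "(\<lambda>n. of_nat (Suc n) * b' n * z ^ n) sums g z" if z: "z \<in> insert a S" for z
  proof -
    have z1: "cmod z < 1"
      using z insert.prems(1) by auto
    have az: "cmod (cnj a * z) < 1"
      using a z1 mult_strict_mono'[of "cmod a" 1 "cmod z" 1] by (simp add: norm_mult)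
    have K: "(\<lambda>n. \<beta> * of_real P * (of_nat (Suc n) * (cnj a * z) ^ n)) sums
        (\<beta> * of_real P * (1 / (1 - cnj a * z)\<^sup>2))"
      using az by (intro sums_mult geometric_deriv_sums)
    let ?H = "\<lambda>n. of_nat (Suc n) * b n * z ^ n"
    have sH: "summable (\<lambda>n. cmod (?H n))"
    proof (rule summable_comparison_test'[where N = 0])
      show "summable (\<lambda>n. C * (18 * \<mu>) * (real (Suc n) * cmod z ^ n))"
        using z1 geometric_deriv_sums[of "cmod z"] by (intro summable_mult) (auto intro: sums_summable)
      show "norm (cmod (?H n)) \<le> C * (18 * \<mu>) * (real (Suc n) * cmod z ^ n)" for n
        using mult_right_mono[OF b(3), of "real (Suc n) * cmod z ^ n" n]
        by (simp add: norm_mult norm_power mult_ac del: of_nat_Suc)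
    qed
    have sp: "summable (\<lambda>n. cmod (p n * z ^ n))"
    proof (rule summable_comparison_test'[OF p(1), of 0])
      show "norm (cmod (p n * z ^ n)) \<le> cmod (p n)" for n
        using z1 by (simp add: norm_mult norm_power mult_left_le power_le_one)
    qed
    have conv: "(\<Sum>j\<le>n. (p j * z ^ j) * ?H (n - j)) = v n * z ^ n" for n
      unfolding v_def sum_distrib_right
    proof (rule sum.cong)
      fix j assume "j \<in> {..n}"
      then have "z ^ n = z ^ j * z ^ (n - j)"
        by (simp flip: power_add)
      then show "(p j * z ^ j) * ?H (n - j) = p j * (of_nat (Suc (n - j)) * b (n - j)) * z ^ n"
        by (simp add: mult_ac)
    qed simp
    have "(\<lambda>n. v n * z ^ n) sums ((\<Sum>n. p n * z ^ n) * (\<Sum>n. ?H n))"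
      using Cauchy_product_sums[OF sp sH] unfolding conv .
    moreover have "(\<Sum>n. p n * z ^ n) = (z - a) / (1 - cnj a * z)"
      using p(3)[OF z1] by (rule sums_unique[symmetric])
    \<comment> \<open>At \<open>z = a\<close> the factor vanishes, so it does not matter that the series need not equal \<open>G a\<close>.\<close>
    moreover have "(z - a) / (1 - cnj a * z) * (\<Sum>n. ?H n) = (z - a) / (1 - cnj a * z) * G z"
      using z b(4) sums_unique by fastforce
    ultimately have "(\<lambda>n. v n * z ^ n) sums ((z - a) / (1 - cnj a * z) * G z)"
      by (simp only:)
    from sums_add[OF K this] have "(\<lambda>n. \<beta> * of_real P * (of_nat (Suc n) * (cnj a * z) ^ n) + v n * z ^ n) sums g z"
      using g[OF z1] by simp
    moreover have "\<beta> * of_real P * (of_nat (Suc n) * (cnj a * z) ^ n) + v n * z ^ n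
        = of_nat (Suc n) * b' n * z ^ n" for n
    proof -
      have "of_nat (Suc n) * (v n / of_nat (Suc n)) = v n"
        by (simp del: of_nat_Suc)
      then show ?thesis
        unfolding b'_def distrib_left distrib_right power_mult_distrib by (simp add: mult_ac del: of_nat_Suc)
    qed
    ultimately show ?thesis by (simp only:)
  qed
  show ?case
    unfolding C(2) using sm total each interp by blast
qed

section \<open>Sequences in the Bloch space\<close>

lemma small_factor:
  fixes x D e :: real
  assumes "0 \<le> x" "0 < D" "0 < e"
  shows "\<exists>\<epsilon>>0. D * (x * \<epsilon>) \<le> e"
proof (intro exI conjI)
  show "0 < e / (D * (x + 1))"
    using assms by simp
  have "D * (x * (e / (D * (x + 1)))) = e * (x / (x + 1))"
    using assms by simp
  also have "\<dots> \<le> e * 1"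
    using assms by (intro mult_left_mono) auto
  finally show "D * (x * (e / (D * (x + 1)))) \<le> e" by simp
qed

lemma small_square_weight_of_small_on_compacts:
  fixes h :: "nat \<Rightarrow> complex \<Rightarrow> complex"
  assumes M: "\<And>m z. cmod z < 1 \<Longrightarrow> (1 - (cmod z)\<^sup>2) * cmod (h m z) \<le> M"
    and lim: "\<And>K. compact K \<Longrightarrow> K \<subseteq> ball 0 1 \<Longrightarrow> uniform_limit K h (\<lambda>z. 0) sequentially"
    and \<eta>: "0 < \<eta>"
  shows "\<forall>\<^sub>F m in sequentially. \<forall>z\<in>ball 0 1. (1 - (cmod z)\<^sup>2)\<^sup>2 * cmod (h m z) \<le> \<eta>"
proof -
  have M0: "0 \<le> M"
    using M[of 0 0] order_trans[OF norm_ge_zero[of "h 0 0"]] by simp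
  define \<delta> where "\<delta> = \<eta> / (M + \<eta>)"
  define K where "K = cball (0 :: complex) (sqrt (1 - \<delta>))"
  have \<delta>: "0 < \<delta>" "\<delta> \<le> 1" "\<delta> * M \<le> \<eta>"
    using \<eta> M0 by (auto simp: \<delta>_def field_simps)
  have "sqrt (1 - \<delta>) < 1"
    using \<delta>(1) by simp
  then have "K \<subseteq> ball 0 1"
    by (simp add: K_def cball_subset_ball_iff)
  then have "uniform_limit K h (\<lambda>z. 0) sequentially"
    by (intro lim) (auto simp: K_def)
  then have "\<forall>\<^sub>F m in sequentially. \<forall>z\<in>K. cmod (h m z) < \<eta>"
    using \<eta> uniform_limitD by fastforce
  then show ?thesis
  proof (rule eventually_mono, intro ballI)
    fix m z assume small: "\<forall>z\<in>K. cmod (h m z) < \<eta>" and z: "z \<in> ball (0::complex) 1"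
    let ?w = "1 - (cmod z)\<^sup>2"
    have w: "0 \<le> ?w" "?w \<le> 1"
      using z by (auto simp: power_le_one)
    show "?w\<^sup>2 * cmod (h m z) \<le> \<eta>"
    \<comment> \<open>Off \<open>K\<close> one factor of the weight is at most \<open>\<delta>\<close> and the other is absorbed by \<open>M\<close>.\<close>
    proof (cases "z \<in> K")
      case True
      have "?w\<^sup>2 * cmod (h m z) \<le> 1 * cmod (h m z)"
        using w by (intro mult_right_mono) (auto simp: power_le_one)
      then show ?thesis
        using small True by fastforce
    next
      case False
      then have "sqrt (1 - \<delta>) < cmod z"
        by (simp add: K_def)
      then have "?w \<le> \<delta>"
        using \<delta> real_sqrt_less_iff[of "1 - \<delta>" "(cmod z)\<^sup>2"] by simp
      then have "?w * (?w * cmod (h m z)) \<le> \<delta> * M"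
        using w M[of z m] z \<delta> by (intro mult_mono) auto
      then show ?thesis
        using \<delta>(3) by (simp add: power2_eq_square mult_ac)
    qed
  qed
qed

text \<open>
  The weighted bound gives a uniform bound on each compact set, with the weight taken at a point of
  maximal modulus.
\<close>

lemma weighted_montel:
  fixes h :: "nat \<Rightarrow> complex \<Rightarrow> complex"
  assumes hol: "\<And>m. h m holomorphic_on ball 0 1"
    and bound: "\<And>m z. z \<in> ball 0 1 \<Longrightarrow> (1 - (cmod z)\<^sup>2) * cmod (h m z) \<le> 1"
  obtains g r where "g holomorphic_on ball 0 1" "strict_mono (r :: nat \<Rightarrow> nat)"
    "\<And>z. z \<in> ball 0 1 \<Longrightarrow> (\<lambda>m. h (r m) z) \<longlonglongrightarrow> g z"
    "\<And>K. compact K \<Longrightarrow> K \<subseteq> ball 0 1 \<Longrightarrow> uniform_limit K (\<lambda>m. h (r m)) g sequentially"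
proof (rule Montel[of "ball 0 1" "range h" h])
  show "\<exists>B. \<forall>u\<in>range h. \<forall>z\<in>K. cmod (u z) \<le> B" if K: "compact K" "K \<subseteq> ball 0 1" for K
  proof (cases "K = {}")
    case False
    obtain w where w: "w \<in> K" "\<And>z. z \<in> K \<Longrightarrow> cmod z \<le> cmod w"
      using continuous_attains_sup[OF K(1) False continuous_on_norm_id] by blast
    have pos: "0 < 1 - (cmod w)\<^sup>2"
      using w(1) K(2) by (auto simp: abs_square_less_1)
    have "cmod (h m z) \<le> 1 / (1 - (cmod w)\<^sup>2)" if "z \<in> K" for m z
    proof -
      have "(1 - (cmod w)\<^sup>2) * cmod (h m z) \<le> (1 - (cmod z)\<^sup>2) * cmod (h m z)"
        using w(2)[OF that] by (intro mult_right_mono) (auto intro: power_mono)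
      also have "\<dots> \<le> 1"
        using that K(2) by (intro bound) blast
      finally show ?thesis
        using pos by (simp add: field_simps)
    qed
    then show ?thesis by blast
  qed simp
next
  fix g r
  assume "g holomorphic_on ball 0 1" "strict_mono (r :: nat \<Rightarrow> nat)"
    "\<And>z. z \<in> ball 0 1 \<Longrightarrow> (\<lambda>m. h (r m) z) \<longlonglongrightarrow> g z"
    "\<And>K. compact K \<Longrightarrow> K \<subseteq> ball 0 1 \<Longrightarrow> uniform_limit K (h \<circ> r) g sequentially"
  then show thesis
    by (intro that[of g r]) (simp_all add: o_def)
qed (use hol in blast)+

lemma half_power_unit_ball:
  "(\<lambda>z. if z \<in> ball 0 1 then (1/2) * z ^ Suc n else (0::complex)) \<in> {f \<in> bloch_space. bloch_norm f \<le> 1}"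
proof -
  define e where "e = (\<lambda>z. if z \<in> ball 0 1 then (1/2) * z ^ Suc n else (0::complex))"
  have d: "(e has_field_derivative (1/2) * (of_nat (Suc n) * z ^ n)) (at z)" if z: "z \<in> ball 0 1" for z
  proof (rule has_field_derivative_transform_within_open[OF _ open_ball z])
    show "((\<lambda>z. (1/2) * z ^ Suc n) has_field_derivative (1/2) * (of_nat (Suc n) * z ^ n)) (at z)"
      using DERIV_power[OF DERIV_ident, where n = "Suc n" and x = z] by (intro DERIV_cmult) simp
  qed (simp add: e_def)
  then have hol: "e holomorphic_on ball 0 1"
    unfolding holomorphic_on_open[OF open_ball] by blast
  have le: "(1 - (cmod z)\<^sup>2) * cmod (deriv e z) \<le> 1" if z: "z \<in> ball 0 1" for z
  proof -
    define x where "x = cmod z"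
    have x: "0 \<le> x" "x < 1"
      using z by (auto simp: x_def)
    have "real (Suc n) * x ^ n = (\<Sum>j<Suc n. x ^ n)" by simp
    also have "\<dots> \<le> (\<Sum>j<Suc n. x ^ j)"
      using x by (intro sum_mono power_decreasing) auto
    \<comment> \<open>\<open>x ^ n\<close> is the smallest term of the geometric sum, so \<open>(1 - x) * (n + 1) * x ^ n \<le> 1\<close>.\<close>
    finally have "(1 - x) * (real (Suc n) * x ^ n) \<le> (1 - x) * (\<Sum>j<Suc n. x ^ j)"
      using x by (intro mult_left_mono) auto
    also have "\<dots> = 1 - x ^ Suc n"
      by (rule one_diff_power_eq[symmetric])
    also have "\<dots> \<le> 1"
      using x by simp
    finally have "(1 + x) / 2 * ((1 - x) * (real (Suc n) * x ^ n)) \<le> 1 * 1"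
      using x by (intro mult_mono) auto
    moreover have "cmod (deriv e z) = (1/2) * (real (Suc n) * x ^ n)"
      by (simp add: DERIV_imp_deriv[OF d[OF z]] norm_mult norm_power norm_divide x_def del: of_nat_Suc)
    moreover have "(1 - x\<^sup>2) * ((1/2) * y) = (1 + x) / 2 * ((1 - x) * y)" for y
      by (simp add: power2_eq_square field_simps)
    ultimately show ?thesis
      by (simp only: x_def[symmetric])
  qed
  have "bloch_seminorm e \<le> 1"
    unfolding bloch_seminorm_def using le by (intro cSUP_least) auto
  moreover have "bloch_function e"
    unfolding bloch_function_def using hol le by (intro conjI bdd_aboveI2) auto
  ultimately show ?thesis
    unfolding e_def[symmetric] by (simp add: bloch_space_def bloch_norm_def e_def)
qed

lemma bloch_norm_scale_le:
  assumes g: "bloch_function g" and f: "\<And>z. z \<in> ball 0 1 \<Longrightarrow> f z = a * g z"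
  shows "bloch_norm f \<le> cmod a * bloch_norm g"
proof -
  have "(1 - (cmod z)\<^sup>2) * cmod (deriv f z) \<le> cmod a * bloch_seminorm g" if z: "z \<in> ball 0 1" for z
  proof -
    have "(g has_field_derivative deriv g z) (at z)"
      using g z by (auto simp: bloch_function_def intro: holomorphic_derivI)
    then have "((\<lambda>z. a * g z) has_field_derivative a * deriv g z) (at z)"
      by (rule DERIV_cmult)
    then have "(f has_field_derivative a * deriv g z) (at z)"
      by (rule has_field_derivative_transform_within_open[OF _ open_ball z]) (simp add: f)
    then have "cmod (deriv f z) = cmod a * cmod (deriv g z)"
      by (simp add: DERIV_imp_deriv norm_mult)
    then show ?thesis
      using mult_left_mono[OF bloch_seminorm_upper[OF g z] norm_ge_zero[of a]] by (simp add: mult_ac)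
  qed
  then have "bloch_seminorm f \<le> cmod a * bloch_seminorm g"
    unfolding bloch_seminorm_def[of f] by (intro cSUP_least) auto
  then show ?thesis
    by (simp add: bloch_norm_def f norm_mult distrib_left)
qed

lemma bloch_point_evaluation_bound:
  assumes h: "bloch_function h" and z: "z \<in> ball 0 1"
  shows "cmod (h z) \<le> bloch_norm h / (1 - (cmod z)\<^sup>2)"
proof -
  let ?s = "bloch_seminorm h" and ?p = "1 - (cmod z)\<^sup>2"
  have p: "0 < ?p" "?p \<le> 1"
    using z by (auto simp: abs_square_less_1)
  have s: "0 \<le> ?s"
    using h by (rule bloch_seminorm_nonneg)
  have sub: "cball (0::complex) (cmod z) \<subseteq> ball 0 1"
    using z by auto
  have "cmod (h z - h 0) \<le> ?s / ?p * cmod (z - 0)"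
  proof (rule field_differentiable_bound[OF convex_cball[of "0::complex" "cmod z"]])
    fix w :: complex assume w: "w \<in> cball 0 (cmod z)"
    then show "(h has_field_derivative deriv h w) (at w within cball 0 (cmod z))"
      using sub h holomorphic_derivI[of h "ball 0 1" w]
      by (auto simp: bloch_function_def intro: has_field_derivative_at_within)
    have "?p * cmod (deriv h w) \<le> (1 - (cmod w)\<^sup>2) * cmod (deriv h w)"
      using w by (intro mult_right_mono) (auto intro: power_mono)
    also have "\<dots> \<le> ?s"
      using h sub w by (intro bloch_seminorm_upper) auto
    finally show "cmod (deriv h w) \<le> ?s / ?p"
      using p by (simp add: field_simps)
  qed auto
  also have "\<dots> \<le> ?s / ?p * 1"
    using z s p by (intro mult_left_mono) auto
  finally have "cmod (h z) \<le> cmod (h 0) + ?s / ?p"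
    using norm_triangle_sub[of "h z" "h 0"] by simp
  also have "\<dots> \<le> cmod (h 0) / ?p + ?s / ?p"
    using p by (simp add: le_divide_eq mult_left_le)
  finally show ?thesis
    by (simp add: bloch_norm_def add_divide_distrib)
qed

lemma bloch_dist_tendsto_pointwise:
  assumes lim: "(\<lambda>n. bloch_dist (f n) l) \<longlonglongrightarrow> 0"
    and f: "\<And>n. f n \<in> bloch_space" and l: "l \<in> bloch_space" and z: "z \<in> ball 0 1"
  shows "(\<lambda>n. f n z) \<longlonglongrightarrow> l z"
proof -
  have "(\<lambda>n. f n z - l z) \<longlonglongrightarrow> 0"
  proof (rule Lim_null_comparison)
    show "\<forall>\<^sub>F n in sequentially. cmod (f n z - l z) \<le> bloch_dist (f n) l / (1 - (cmod z)\<^sup>2)"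
      using bloch_point_evaluation_bound[OF bloch_function_diff z, of _ l] f l
      by (simp add: bloch_dist_def bloch_space_def)
    show "(\<lambda>n. bloch_dist (f n) l / (1 - (cmod z)\<^sup>2)) \<longlonglongrightarrow> 0"
      using tendsto_divide_zero[OF lim] .
  qed
  then show ?thesis
    by (rule LIM_zero_cancel)
qed

section \<open>Linear combinations of composition operators\<close>

text \<open>The linear combination of composition operators, with values extended by \<open>0\<close> off the disk.\<close>

definition comb :: "nat \<Rightarrow> (nat \<Rightarrow> complex) \<Rightarrow> (nat \<Rightarrow> complex \<Rightarrow> complex) \<Rightarrow>
    (complex \<Rightarrow> complex) \<Rightarrow> complex \<Rightarrow> complex" where
  "comb k c \<phi> = (\<lambda>f z. \<Sum>i=1..k. c i * comp_op (\<phi> i) f z)"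

text \<open>
  The linear combination of the \<open>n\<close>-th powers of the symbols. On the disk it is the image of
  \<open>z ^ n\<close> under \<open>comb\<close>; off the disk it is not set to \<open>0\<close>.
\<close>

definition power_comb :: "nat \<Rightarrow> (nat \<Rightarrow> complex) \<Rightarrow> (nat \<Rightarrow> complex \<Rightarrow> complex) \<Rightarrow>
    nat \<Rightarrow> complex \<Rightarrow> complex" where
  "power_comb k c \<phi> n = (\<lambda>z. \<Sum>i=1..k. c i * \<phi> i z ^ n)"

lemma self_map_less: "analytic_self_map \<psi> \<Longrightarrow> cmod z < 1 \<Longrightarrow> cmod (\<psi> z) < 1"
  unfolding analytic_self_map_def by fastforce

lemma self_map_derivative:
  "analytic_self_map \<psi> \<Longrightarrow> cmod z < 1 \<Longrightarrow> (\<psi> has_field_derivative deriv \<psi> z) (at z)"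
  unfolding analytic_self_map_def by (auto intro: holomorphic_derivI)

lemma comb_outside: "z \<notin> ball 0 1 \<Longrightarrow> comb k c \<phi> f z = 0"
  by (auto simp: comb_def comp_op_def intro!: sum.neutral)

lemma comb_inside: "z \<in> ball 0 1 \<Longrightarrow> comb k c \<phi> f z = (\<Sum>i=1..k. c i * f (\<phi> i z))"
  by (simp add: comb_def comp_op_def)

lemma comb_linear: "comb k c \<phi> (\<lambda>z. a * f z + b * g z) = (\<lambda>z. a * comb k c \<phi> f z + b * comb k c \<phi> g z)"
proof
  fix z show "comb k c \<phi> (\<lambda>z. a * f z + b * g z) z = a * comb k c \<phi> f z + b * comb k c \<phi> g z"
    by (cases "z \<in> ball 0 1")
      (simp_all add: comb_inside comb_outside sum_distrib_left algebra_simps sum.distrib)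
qed

lemma comb_has_derivative:
  assumes \<phi>: "\<forall>i\<in>{1..k}. analytic_self_map (\<phi> i)"
    and f: "f holomorphic_on ball 0 1" and w: "cmod w < 1"
  shows "(comb k c \<phi> f has_field_derivative (\<Sum>i=1..k. c i * (deriv f (\<phi> i w) * deriv (\<phi> i) w))) (at w)"
proof (rule has_field_derivative_transform_within_open[OF _ open_ball])
  show "((\<lambda>z. \<Sum>i=1..k. c i * f (\<phi> i z)) has_field_derivative
      (\<Sum>i=1..k. c i * (deriv f (\<phi> i w) * deriv (\<phi> i) w))) (at w)"
  proof (intro DERIV_sum DERIV_cmult)
    fix i assume i: "i \<in> {1..k}"
    have "(f has_field_derivative deriv f (\<phi> i w)) (at (\<phi> i w))"
      using f self_map_less[OF bspec[OF \<phi> i] w] by (intro holomorphic_derivI[of f "ball 0 1"]) auto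
    then show "((\<lambda>z. f (\<phi> i z)) has_field_derivative deriv f (\<phi> i w) * deriv (\<phi> i) w) (at w)"
      using self_map_derivative[OF bspec[OF \<phi> i] w] by (rule DERIV_chain2)
  qed
  show "w \<in> ball 0 1" using w by simp
qed (simp add: comb_inside)

lemma comb_holomorphic:
  assumes \<phi>: "\<forall>i\<in>{1..k}. analytic_self_map (\<phi> i)" and f: "f holomorphic_on ball 0 1"
  shows "comb k c \<phi> f holomorphic_on ball 0 1"
  unfolding holomorphic_on_open[OF open_ball] using comb_has_derivative[OF \<phi> f] by (meson mem_ball_0)

lemma power_comb_eq_comb: "z \<in> ball 0 1 \<Longrightarrow> power_comb k c \<phi> n z = comb k c \<phi> (\<lambda>z. z ^ n) z"
  by (simp add: power_comb_def comb_inside)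

lemma power_comb_has_derivative:
  assumes \<phi>: "\<forall>i\<in>{1..k}. analytic_self_map (\<phi> i)"
    and w: "cmod w < 1"
  shows "(power_comb k c \<phi> (Suc n) has_field_derivative
    (\<Sum>i=1..k. c i * (of_nat (Suc n) * \<phi> i w ^ n * deriv (\<phi> i) w))) (at w)"
proof (rule has_field_derivative_transform_within_open[OF _ open_ball])
  have d: "deriv (\<lambda>z. z ^ Suc n) u = of_nat (Suc n) * u ^ n" for u :: complex
    using DERIV_power[OF DERIV_ident, where n = "Suc n" and x = u] by (intro DERIV_imp_deriv) simp
  show "(comb k c \<phi> (\<lambda>z. z ^ Suc n) has_field_derivative
    (\<Sum>i=1..k. c i * (of_nat (Suc n) * \<phi> i w ^ n * deriv (\<phi> i) w))) (at w)"
    using comb_has_derivative[OF \<phi> _ w, where f = "\<lambda>z. z ^ Suc n"] unfolding d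
    by (rule meta_mp[rotated]) (intro holomorphic_intros)
  show "w \<in> ball 0 1" using w by simp
qed (simp add: power_comb_eq_comb)

lemma power_comb_bloch:
  assumes \<phi>: "\<forall>i\<in>{1..k}. analytic_self_map (\<phi> i)"
  shows "bloch_function (power_comb k c \<phi> n)"
proof (rule bloch_function_bounded)
  show "power_comb k c \<phi> n holomorphic_on ball 0 1"
    using \<phi> unfolding power_comb_def analytic_self_map_def by (intro holomorphic_intros) auto
  show "cmod (power_comb k c \<phi> n z) \<le> (\<Sum>i=1..k. cmod (c i))" if "z \<in> ball 0 1" for z
    unfolding power_comb_def
  proof (rule sum_norm_le)
    fix i assume "i \<in> {1..k}"
    then have "cmod (\<phi> i z) < 1"
      using self_map_less[OF bspec[OF \<phi>]] that by simp
    then show "cmod (c i * \<phi> i z ^ n) \<le> cmod (c i)"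
      by (simp add: norm_mult norm_power mult_left_le power_le_one)
  qed
qed

lemma power_comb_derivative_bound:
  assumes \<phi>: "\<forall>i\<in>{1..k}. analytic_self_map (\<phi> i)"
    and w: "cmod w < 1"
  shows "(1 - (cmod w)\<^sup>2) * cmod (\<Sum>i=1..k. c i * (of_nat (Suc n) * \<phi> i w ^ n * deriv (\<phi> i) w))
    \<le> bloch_seminorm (power_comb k c \<phi> (Suc n))"
  using bloch_seminorm_upper[OF power_comb_bloch[OF \<phi>], of w c "Suc n"] w
    DERIV_imp_deriv[OF power_comb_has_derivative[OF \<phi> w, of c n]] by simp

text \<open>
  The central estimate: \<open>f'\<close> is interpolated at the points \<open>\<phi> i w\<close> by a series with coefficients \<open>b\<close>.
  The terms with \<open>n < N\<close> are estimated by the uniform bound on \<open>b n\<close>, the others by the bound on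
  the sum of all \<open>\<bar>b n\<bar>\<close>.
\<close>

lemma comb_derivative_bound:
  assumes \<phi>: "\<forall>i\<in>{1..k}. analytic_self_map (\<phi> i)"
    and f: "f holomorphic_on ball 0 1"
    and M: "\<And>z. cmod z < 1 \<Longrightarrow> (1 - (cmod z)\<^sup>2) * cmod (deriv f z) \<le> M"
    and \<mu>: "\<And>z. cmod z < 1 \<Longrightarrow> (1 - (cmod z)\<^sup>2)\<^sup>2 * cmod (deriv f z) \<le> \<mu>"
    and B: "\<And>n. bloch_seminorm (power_comb k c \<phi> (Suc n)) \<le> B"
    and \<epsilon>: "\<And>n. N \<le> n \<Longrightarrow> bloch_seminorm (power_comb k c \<phi> (Suc n)) \<le> \<epsilon>"
    and w: "cmod w < 1"
  shows "(1 - (cmod w)\<^sup>2) * cmod (deriv (comb k c \<phi> f) w) \<le> 56 ^ k * (real N * \<mu> * B + M * \<epsilon>)"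
proof -
  define S where "S = (\<lambda>i. \<phi> i w) ` {1..k}"
  have S: "finite S" "S \<subseteq> ball 0 1"
    using self_map_less[OF bspec[OF \<phi>]] w by (auto simp: S_def)
  have "card S \<le> k"
    unfolding S_def using card_image_le[of "{1..k}"] by simp
  then have power: "(56::real) ^ card S \<le> 56 ^ k"
    by (simp add: power_increasing)
  have M0: "0 \<le> M"
    using M[of 0] order_trans[OF norm_ge_zero[of "deriv f 0"]] by simp
  have \<mu>0: "0 \<le> \<mu>"
    using \<mu>[of 0] order_trans[OF norm_ge_zero[of "deriv f 0"]] by simp
  have E0: "0 \<le> bloch_seminorm (power_comb k c \<phi> n)" for n
    using power_comb_bloch[OF \<phi>] by (rule bloch_seminorm_nonneg)
  have B0: "0 \<le> B" and \<epsilon>0: "0 \<le> \<epsilon>"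
    using E0 B \<epsilon>[of N] order_trans by blast+
  have "deriv f holomorphic_on ball 0 1"
    using f by (intro holomorphic_deriv) auto
  then obtain b where b: "summable (\<lambda>n. cmod (b n))"
    "(\<Sum>n. cmod (b n)) \<le> 56 ^ card S * M" "\<And>n. cmod (b n) \<le> 56 ^ card S * \<mu>"
    "\<And>z. z \<in> S \<Longrightarrow> (\<lambda>n. of_nat (Suc n) * b n * z ^ n) sums deriv f z"
    using bloch_interpolation[OF S _ M \<mu>] by blast
  \<comment> \<open>\<open>L n\<close> is the weighted derivative at \<open>w\<close> of the image of \<open>z ^ Suc n\<close>.\<close>
  define L where "L = (\<lambda>n. of_real (1 - (cmod w)\<^sup>2) *
    (\<Sum>i=1..k. c i * (of_nat (Suc n) * \<phi> i w ^ n * deriv (\<phi> i) w)))"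
  have wt: "0 \<le> 1 - (cmod w)\<^sup>2"
    using w by (simp add: power_le_one)
  then have normL: "cmod (L n) \<le> bloch_seminorm (power_comb k c \<phi> (Suc n))" for n
    using power_comb_derivative_bound[OF \<phi> w, of c n] unfolding L_def norm_mult norm_of_real by simp
  have "(\<lambda>n. of_real (1 - (cmod w)\<^sup>2) * (\<Sum>i=1..k. c i * ((of_nat (Suc n) * b n * \<phi> i w ^ n) * deriv (\<phi> i) w)))
    sums (of_real (1 - (cmod w)\<^sup>2) * (\<Sum>i=1..k. c i * (deriv f (\<phi> i w) * deriv (\<phi> i) w)))"
    by (intro sums_mult sums_sum sums_mult2 b(4)) (simp add: S_def)
  moreover have "(\<Sum>i=1..k. c i * (deriv f (\<phi> i w) * deriv (\<phi> i) w)) = deriv (comb k c \<phi> f) w"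
    using comb_has_derivative[OF \<phi> f w] by (rule DERIV_imp_deriv[symmetric])
  moreover have "of_real (1 - (cmod w)\<^sup>2) *
      (\<Sum>i=1..k. c i * ((of_nat (Suc n) * b n * \<phi> i w ^ n) * deriv (\<phi> i) w)) = b n * L n" for n
    by (simp add: L_def sum_distrib_left mult_ac del: of_nat_Suc)
  ultimately have sums: "(\<lambda>n. b n * L n) sums (of_real (1 - (cmod w)\<^sup>2) * deriv (comb k c \<phi> f) w)"
    by (simp only:)
  have major: "(\<lambda>n. (if n \<in> {..<N} then 56 ^ k * \<mu> * B else 0) + \<epsilon> * cmod (b n)) sums
      ((\<Sum>n<N. 56 ^ k * \<mu> * B) + \<epsilon> * (\<Sum>n. cmod (b n)))"
    by (intro sums_add sums_If_finite_set sums_mult summable_sums b(1)) simp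
  have each: "cmod (b n * L n) \<le> (if n \<in> {..<N} then 56 ^ k * \<mu> * B else 0) + \<epsilon> * cmod (b n)" for n
  proof (cases "n < N")
    case True
    have "cmod (b n) \<le> 56 ^ k * \<mu>"
      using b(3)[of n] mult_right_mono[OF power \<mu>0] by simp
    then have "cmod (b n) * cmod (L n) \<le> 56 ^ k * \<mu> * B"
      using order_trans[OF normL B] \<mu>0 by (intro mult_mono) auto
    then show ?thesis
      using True \<epsilon>0 by (simp add: norm_mult add_increasing2)
  next
    case False
    then show ?thesis
      using order_trans[OF normL \<epsilon>, of n] by (simp add: norm_mult mult.commute mult_right_mono)
  qed
  have "cmod (of_real (1 - (cmod w)\<^sup>2) * deriv (comb k c \<phi> f) w)
      \<le> (\<Sum>n<N. 56 ^ k * \<mu> * B) + \<epsilon> * (\<Sum>n. cmod (b n))"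
    using norm_suminf_le[OF each sums_summable[OF major]] sums_unique[OF sums] sums_unique[OF major]
    by simp
  also have "\<dots> \<le> real N * (56 ^ k * \<mu> * B) + \<epsilon> * (56 ^ k * M)"
    using order_trans[OF b(2) mult_right_mono[OF power M0]] \<epsilon>0 by (simp add: mult_left_mono)
  also have "\<dots> = 56 ^ k * (real N * \<mu> * B + M * \<epsilon>)"
    by (simp add: algebra_simps)
  finally show ?thesis
    using wt unfolding norm_mult norm_of_real by simp
qed

text \<open>The case \<open>N = 0\<close> of the estimate shows that the Bloch space is mapped to itself.\<close>

lemma comb_bloch_space:
  assumes \<phi>: "\<forall>i\<in>{1..k}. analytic_self_map (\<phi> i)"
    and B: "\<And>n. bloch_seminorm (power_comb k c \<phi> (Suc n)) \<le> B" and f: "f \<in> bloch_space"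
  shows "comb k c \<phi> f \<in> bloch_space"
proof -
  have bf: "bloch_function f" and hol: "f holomorphic_on ball 0 1"
    using f by (auto simp: bloch_space_def bloch_function_def)
  let ?M = "bloch_seminorm f"
  have M: "(1 - (cmod z)\<^sup>2) * cmod (deriv f z) \<le> ?M" if "cmod z < 1" for z
    using bloch_seminorm_upper[OF bf] that by simp
  have \<mu>: "(1 - (cmod z)\<^sup>2)\<^sup>2 * cmod (deriv f z) \<le> ?M" if "cmod z < 1" for z
  proof -
    have "(1 - (cmod z)\<^sup>2) * ((1 - (cmod z)\<^sup>2) * cmod (deriv f z)) \<le> 1 * ?M"
      using M[OF that] that by (intro mult_mono) (auto simp: power_le_one)
    then show ?thesis
      by (simp add: power2_eq_square mult_ac)
  qed
  have "(1 - (cmod w)\<^sup>2) * cmod (deriv (comb k c \<phi> f) w) \<le> 56 ^ k * (real 0 * ?M * B + ?M * B)"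
    if "w \<in> ball 0 1" for w
    by (rule comb_derivative_bound[OF \<phi> hol M \<mu> B B]) (use that in auto)
  then show ?thesis
    using comb_holomorphic[OF \<phi> hol] comb_outside
    by (auto simp: bloch_space_def bloch_function_def intro!: bdd_aboveI2)
qed

lemma comb_tendsto_0:
  assumes \<phi>: "\<forall>i\<in>{1..k}. analytic_self_map (\<phi> i)"
    and E: "(\<lambda>n. bloch_norm (power_comb k c \<phi> n)) \<longlonglongrightarrow> 0"
    and h: "\<And>m. h m holomorphic_on ball 0 1"
    and M: "\<And>m z. cmod z < 1 \<Longrightarrow> (1 - (cmod z)\<^sup>2) * cmod (deriv (h m) z) \<le> M"
    and h0: "(\<lambda>m. h m 0) \<longlonglongrightarrow> 0"
    and lim: "\<And>K. compact K \<Longrightarrow> K \<subseteq> ball 0 1 \<Longrightarrow>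
      uniform_limit K (\<lambda>m. deriv (h m)) (\<lambda>z. 0) sequentially"
  shows "(\<lambda>m. bloch_norm (comb k c \<phi> (h m))) \<longlonglongrightarrow> 0"
proof -
  have M0: "0 \<le> M"
    using M[of 0 0] order_trans[OF norm_ge_zero[of "deriv (h 0) 0"]] by simp
  have E0: "0 \<le> bloch_seminorm (power_comb k c \<phi> n)" for n
    using power_comb_bloch[OF \<phi>] by (rule bloch_seminorm_nonneg)
  have "(\<lambda>n. bloch_norm (power_comb k c \<phi> (Suc n))) \<longlonglongrightarrow> 0"
    using E by (rule LIMSEQ_Suc)
  then have E1: "(\<lambda>n. bloch_seminorm (power_comb k c \<phi> (Suc n))) \<longlonglongrightarrow> 0"
    by (rule tendsto_sandwich[OF _ _ tendsto_const, rotated 2])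
      (auto simp: E0 bloch_norm_def)
  then have "Bseq (\<lambda>n. bloch_seminorm (power_comb k c \<phi> (Suc n)))"
    using convergentI convergent_imp_Bseq by blast
  then have "\<exists>B>0. \<forall>n. norm (bloch_seminorm (power_comb k c \<phi> (Suc n))) \<le> B"
    unfolding Bseq_def .
  then obtain B where B: "0 < B" "\<And>n. bloch_seminorm (power_comb k c \<phi> (Suc n)) \<le> B"
    by (metis abs_ge_self order_trans real_norm_def)
  have pointwise: "(\<lambda>m. h m z) \<longlonglongrightarrow> 0" if z: "cmod z < 1" for z
  proof -
    have sub: "cball (0::complex) (cmod z) \<subseteq> ball 0 1"
      using z by auto
    have "(\<lambda>m. h m z - h m 0) \<longlonglongrightarrow> 0"
    proof (rule LIMSEQ_I)
      fix e :: real assume e: "0 < e"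
      have "\<forall>\<^sub>F m in sequentially. \<forall>w\<in>cball (0::complex) (cmod z). cmod (deriv (h m) w) < e / 2"
      proof -
        have "uniform_limit (cball 0 (cmod z)) (\<lambda>m. deriv (h m)) (\<lambda>z. 0) sequentially"
          by (rule lim[OF compact_cball sub])
        from uniform_limitD[OF this half_gt_zero[OF e]] show ?thesis
          by simp
      qed
      then have "\<forall>\<^sub>F m in sequentially. cmod (h m z - h m 0) < e"
      proof (rule eventually_mono)
        fix m assume small: "\<forall>w\<in>cball (0::complex) (cmod z). cmod (deriv (h m) w) < e / 2"
        have "cmod (h m z - h m 0) \<le> e / 2 * cmod (z - 0)"
        proof (rule field_differentiable_bound[OF convex_cball[of "0::complex" "cmod z"]])
          fix w :: complex assume w: "w \<in> cball 0 (cmod z)"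
          then show "(h m has_field_derivative deriv (h m) w) (at w within cball 0 (cmod z))"
            using sub holomorphic_derivI[OF h[of m] open_ball, of w] has_field_derivative_at_within by blast
          show "cmod (deriv (h m) w) \<le> e / 2"
            using small w by fastforce
        qed auto
        also have "\<dots> \<le> e / 2 * 1"
          using z e by (intro mult_left_mono) auto
        finally show "cmod (h m z - h m 0) < e"
          using e by simp
      qed
      then show "\<exists>no. \<forall>m\<ge>no. cmod (h m z - h m 0 - 0) < e"
        by (simp add: eventually_sequentially)
    qed
    from tendsto_add[OF this h0] show ?thesis by simp
  qed
  have "(\<lambda>m. comb k c \<phi> (h m) 0) \<longlonglongrightarrow> (\<Sum>i=1..k. c i * 0)"
    using pointwise self_map_less[OF bspec[OF \<phi>]] by (simp only: comb_inside centre_in_ball zero_less_one)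
      (intro tendsto_sum tendsto_mult tendsto_const; simp)
  then have at0: "(\<lambda>m. cmod (comb k c \<phi> (h m) 0)) \<longlonglongrightarrow> 0"
    using tendsto_norm_zero by simp
  have "(\<lambda>m. bloch_seminorm (comb k c \<phi> (h m))) \<longlonglongrightarrow> 0"
  proof (rule LIMSEQ_I)
    fix e :: real assume e: "0 < e"
    obtain \<epsilon> where \<epsilon>: "0 < \<epsilon>" "56 ^ k * (M * \<epsilon>) \<le> e / 4"
      using small_factor[OF M0, of "56 ^ k" "e / 4"] e by auto
    obtain N where N: "\<And>n. N \<le> n \<Longrightarrow> bloch_seminorm (power_comb k c \<phi> (Suc n)) \<le> \<epsilon>"
      using LIMSEQ_D[OF E1 \<epsilon>(1)] E0 by fastforce
    have "0 \<le> real N * B"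
      using B(1) by simp
    then obtain \<eta> where \<eta>: "0 < \<eta>" "56 ^ k * (real N * B * \<eta>) \<le> e / 4"
      using small_factor[of "real N * B" "56 ^ k" "e / 4"] e by auto
    have "\<forall>\<^sub>F m in sequentially. \<forall>z\<in>ball 0 1. (1 - (cmod z)\<^sup>2)\<^sup>2 * cmod (deriv (h m) z) \<le> \<eta>"
      using M lim \<eta>(1) by (rule small_square_weight_of_small_on_compacts)
    then have "\<forall>\<^sub>F m in sequentially. norm (bloch_seminorm (comb k c \<phi> (h m)) - 0) < e"
    proof (rule eventually_mono)
      fix m assume small: "\<forall>z\<in>ball 0 1. (1 - (cmod z)\<^sup>2)\<^sup>2 * cmod (deriv (h m) z) \<le> \<eta>"
      have le: "(1 - (cmod w)\<^sup>2) * cmod (deriv (comb k c \<phi> (h m)) w) \<le> e / 2" if w: "w \<in> ball 0 1" for w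
      proof -
        have "(1 - (cmod w)\<^sup>2) * cmod (deriv (comb k c \<phi> (h m)) w) \<le> 56 ^ k * (real N * \<eta> * B + M * \<epsilon>)"
          by (rule comb_derivative_bound[OF \<phi> h M _ B(2) N]) (use small w in auto)
        then show ?thesis
          using \<epsilon>(2) \<eta>(2) by (simp add: distrib_left mult_ac)
      qed
      have "bloch_seminorm (comb k c \<phi> (h m)) \<le> e / 2"
        unfolding bloch_seminorm_def using le by (intro cSUP_least) auto
      moreover have "bloch_function (comb k c \<phi> (h m))"
        using comb_holomorphic[OF \<phi> h] le unfolding bloch_function_def
        by (intro conjI bdd_aboveI2[where M = "e / 2"]) auto
      then have "0 \<le> bloch_seminorm (comb k c \<phi> (h m))"
        by (rule bloch_seminorm_nonneg)
      ultimately show "norm (bloch_seminorm (comb k c \<phi> (h m)) - 0) < e"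
        using e by simp
    qed
    then show "\<exists>no. \<forall>m\<ge>no. norm (bloch_seminorm (comb k c \<phi> (h m)) - 0) < e"
      by (simp add: eventually_sequentially)
  qed
  from tendsto_add[OF at0 this] show ?thesis
    by (simp add: bloch_norm_def)
qed

section \<open>The compactness criterion\<close>

lemma compact_of_power_comb_tendsto_0:
  assumes \<phi>: "\<forall>i\<in>{1..k}. analytic_self_map (\<phi> i)"
    and E: "(\<lambda>n. bloch_norm (power_comb k c \<phi> n)) \<longlonglongrightarrow> 0"
  shows "compact_on_bloch (comb k c \<phi>)"
proof -
  have "Bseq (\<lambda>n. bloch_norm (power_comb k c \<phi> n))"
    using E convergentI convergent_imp_Bseq by blast
  then have "\<exists>B>0. \<forall>n. norm (bloch_norm (power_comb k c \<phi> n)) \<le> B"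
    unfolding Bseq_def .
  then obtain B where "\<And>n. bloch_norm (power_comb k c \<phi> n) \<le> B"
    by (metis abs_ge_self order_trans real_norm_def)
  moreover have "bloch_seminorm (power_comb k c \<phi> n) \<le> bloch_norm (power_comb k c \<phi> n)" for n
    by (simp add: bloch_norm_def)
  ultimately have B: "bloch_seminorm (power_comb k c \<phi> n) \<le> B" for n
    using order_trans by blast
  have maps: "comb k c \<phi> f \<in> bloch_space" if "f \<in> bloch_space" for f
    using \<phi> B that by (rule comb_bloch_space)
  define U where "U = {f \<in> bloch_space. bloch_norm f \<le> 1}"
  have "compactin bloch.mtopology (comb k c \<phi> ` U)"
    unfolding bloch.compactin_sequentially
  proof (intro conjI allI impI)
    show "comb k c \<phi> ` U \<subseteq> bloch_space"
      using maps by (auto simp: U_def)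
    fix \<sigma> :: "nat \<Rightarrow> complex \<Rightarrow> complex"
    assume "range \<sigma> \<subseteq> comb k c \<phi> ` U"
    then have "\<forall>m. \<exists>f. f \<in> U \<and> \<sigma> m = comb k c \<phi> f" by blast
    then obtain f where f: "\<And>m. f m \<in> U" "\<And>m. \<sigma> m = comb k c \<phi> (f m)" by metis
    obtain g r where gr: "g \<in> U" "strict_mono r"
      "(\<lambda>m. f (r m) 0) \<longlonglongrightarrow> g 0"
      "\<And>K. compact K \<Longrightarrow> K \<subseteq> ball 0 1 \<Longrightarrow>
        uniform_limit K (\<lambda>m. deriv (f (r m))) (deriv g) sequentially"
    \<comment> \<open>Montel's theorem applies to the derivatives of the \<open>f m\<close>, and the values at the origin are bounded.
      The function \<open>g\<close> is the primitive of the limit of the derivatives that takes the limit of the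
      values at the origin, and the pointwise inequality \<open>le\<close> passes to the limit.\<close>
    proof -
      have fU: "f m \<in> bloch_space \<and> bloch_norm (f m) \<le> 1" for m
        using f(1)[of m] by (simp add: U_def)
      have f': "bloch_function (f m)" "f m holomorphic_on ball 0 1" for m
        using fU[of m] by (auto simp: bloch_space_def bloch_function_def)
      have le: "cmod (f m 0) + (1 - (cmod z)\<^sup>2) * cmod (deriv (f m) z) \<le> 1" if "z \<in> ball 0 1" for m z
        using bloch_seminorm_upper[OF f'(1)[of m] that] fU[of m] unfolding bloch_norm_def by linarith
      have "(1 - (cmod z)\<^sup>2) * cmod (deriv (f m) z) \<le> 1" if "z \<in> ball 0 1" for m z
        using le[OF that, of m] norm_ge_zero[of "f m 0"] by linarith
      moreover have "deriv (f m) holomorphic_on ball 0 1" for m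
        using f'(2) by (intro holomorphic_deriv) auto
      ultimately obtain g' r where g': "g' holomorphic_on ball 0 1" and r: "strict_mono (r :: nat \<Rightarrow> nat)"
        and pw: "\<And>z. z \<in> ball 0 1 \<Longrightarrow> (\<lambda>m. deriv (f (r m)) z) \<longlonglongrightarrow> g' z"
        and un: "\<And>K. compact K \<Longrightarrow> K \<subseteq> ball 0 1 \<Longrightarrow>
          uniform_limit K (\<lambda>m. deriv (f (r m))) g' sequentially"
        using weighted_montel[of "\<lambda>m. deriv (f m)"] by blast
      have "bounded (range (\<lambda>m. f (r m) 0))"
      proof (rule boundedI)
        show "cmod x \<le> 1" if x: "x \<in> range (\<lambda>m. f (r m) 0)" for x
        proof -
          obtain m where "x = f (r m) 0"
            using x by blast
          moreover have "cmod (f (r m) 0) \<le> 1"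
            using fU[of "r m"] bloch_seminorm_nonneg[OF f'(1)[of "r m"]] unfolding bloch_norm_def by linarith
          ultimately show ?thesis by simp
        qed
      qed
      from bounded_imp_convergent_subsequence[OF this]
      obtain l s where s: "strict_mono (s :: nat \<Rightarrow> nat)" and l: "(\<lambda>m. f (r (s m)) 0) \<longlonglongrightarrow> l"
        unfolding o_def by blast
      obtain g0 where g0: "\<And>z. z \<in> ball 0 1 \<Longrightarrow> (g0 has_field_derivative g' z) (at z within ball 0 1)"
        using holomorphic_convex_primitive'[OF convex_ball open_ball g'] by blast
      define g where "g = (\<lambda>z. if z \<in> ball 0 1 then g0 z - g0 0 + l else 0)"
      have dg: "(g has_field_derivative g' z) (at z)" if z: "z \<in> ball 0 1" for z
      proof (rule has_field_derivative_transform_within_open[OF _ open_ball z])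
        show "((\<lambda>z. g0 z - g0 0 + l) has_field_derivative g' z) (at z)"
          using g0[OF z] z at_within_open[OF z open_ball] by (auto intro!: derivative_eq_intros)
      qed (simp add: g_def)
      then have deriv_g: "deriv g z = g' z" if "z \<in> ball 0 1" for z
        using that by (blast intro: DERIV_imp_deriv)
      have hol: "g holomorphic_on ball 0 1"
        using dg unfolding holomorphic_on_open[OF open_ball] by blast
      have g0l: "g 0 = l"
        by (simp add: g_def)
      have g_le: "cmod (g 0) + (1 - (cmod z)\<^sup>2) * cmod (deriv g z) \<le> 1" if z: "z \<in> ball 0 1" for z
      proof (rule LIMSEQ_le_const2)
        have "(\<lambda>m. deriv (f (r (s m))) z) \<longlonglongrightarrow> g' z"
          using LIMSEQ_subseq_LIMSEQ[OF pw[OF z] s] by (simp add: o_def)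
        then show "(\<lambda>m. cmod (f (r (s m)) 0) + (1 - (cmod z)\<^sup>2) * cmod (deriv (f (r (s m))) z))
            \<longlonglongrightarrow> cmod (g 0) + (1 - (cmod z)\<^sup>2) * cmod (deriv g z)"
          unfolding deriv_g[OF z] g0l by (intro tendsto_intros l)
      qed (use le[OF z] in auto)
      have "bloch_seminorm g \<le> 1 - cmod (g 0)"
        unfolding bloch_seminorm_def using g_le by (intro cSUP_least) (auto simp: algebra_simps)
      moreover have "bloch_function g"
        unfolding bloch_function_def
      proof
        show "bdd_above ((\<lambda>z. (1 - (cmod z)\<^sup>2) * cmod (deriv g z)) ` ball 0 1)"
          by (rule bdd_aboveI2[of _ _ "1 - cmod (g 0)"]) (use g_le in \<open>simp add: algebra_simps\<close>)
      qed (fact hol)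
      ultimately have "g \<in> U"
        by (auto simp: U_def bloch_space_def bloch_norm_def g_def)
      moreover have "strict_mono (\<lambda>m. r (s m))"
        using r s by (rule strict_mono_compose)
      moreover have "(\<lambda>m. f (r (s m)) 0) \<longlonglongrightarrow> g 0"
        using l g0l by simp
      moreover have "uniform_limit K (\<lambda>m. deriv (f (r (s m)))) (deriv g) sequentially"
        if K: "compact K" "K \<subseteq> ball 0 1" for K
      proof -
        have "uniform_limit K (\<lambda>m. deriv (f (r (s m)))) g' sequentially"
          using filterlim_compose[OF un[OF K] filterlim_subseq[OF s]] by (simp add: o_def)
        then show ?thesis
          using deriv_g K(2) by (subst uniform_limit_cong'[where i = g']) auto
      qed
      ultimately show thesis
        by (rule that)
    qed
    define h where "h = (\<lambda>m z. f (r m) z - g z)"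
    have U_D: "u holomorphic_on ball 0 1" "bloch_function u"
      "\<And>z. cmod z < 1 \<Longrightarrow> (1 - (cmod z)\<^sup>2) * cmod (deriv u z) \<le> 1" if "u \<in> U" for u
    proof -
      show u: "bloch_function u" "u holomorphic_on ball 0 1"
        using that by (auto simp: U_def bloch_space_def bloch_function_def)
      show "(1 - (cmod z)\<^sup>2) * cmod (deriv u z) \<le> 1" if "cmod z < 1" for z
        using bloch_seminorm_upper[OF u(1), of z] \<open>u \<in> U\<close> that norm_ge_zero[of "u 0"]
        unfolding U_def bloch_norm_def mem_Collect_eq mem_ball_0 by linarith
    qed
    have dh: "deriv (h m) z = deriv (f (r m)) z - deriv g z" if "z \<in> ball 0 1" for m z
      unfolding h_def
      by (intro deriv_diff holomorphic_on_imp_differentiable_at[OF _ open_ball that] U_D(1) f(1) gr(1))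
    have "(\<lambda>m. bloch_norm (comb k c \<phi> (h m))) \<longlonglongrightarrow> 0"
    proof (rule comb_tendsto_0[OF \<phi> E])
      show "h m holomorphic_on ball 0 1" for m
        unfolding h_def using U_D(1) f(1) gr(1) by (intro holomorphic_intros) auto
      show "(1 - (cmod z)\<^sup>2) * cmod (deriv (h m) z) \<le> 2" if z: "cmod z < 1" for m z
      proof -
        have "(1 - (cmod z)\<^sup>2) * cmod (deriv (h m) z)
            \<le> (1 - (cmod z)\<^sup>2) * (cmod (deriv (f (r m)) z) + cmod (deriv g z))"
          using z dh[of z m] norm_triangle_ineq4 by (intro mult_left_mono) (auto simp: power_le_one)
        also have "\<dots> \<le> 2"
          using U_D(3)[OF f(1) z, of "r m"] U_D(3)[OF gr(1) z] by (simp add: distrib_left)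
        finally show ?thesis .
      qed
      show "(\<lambda>m. h m 0) \<longlonglongrightarrow> 0"
        using tendsto_diff[OF gr(3) tendsto_const[of "g 0"]] by (simp add: h_def)
      show "uniform_limit K (\<lambda>m. deriv (h m)) (\<lambda>z. 0) sequentially"
        if K: "compact K" "K \<subseteq> ball 0 1" for K
      proof -
        have "uniform_limit K (\<lambda>m z. deriv (f (r m)) z - deriv g z) (\<lambda>z. deriv g z - deriv g z) sequentially"
          by (intro uniform_limit_intros gr(4)[OF K])
        then show ?thesis
          using dh K(2) by (subst uniform_limit_cong'[where i = "\<lambda>z. deriv g z - deriv g z"]) auto
      qed
    qed
    moreover have "comb k c \<phi> (h m) = (\<lambda>z. comb k c \<phi> (f (r m)) z - comb k c \<phi> g z)" for m
      using comb_linear[of k c \<phi> 1 "f (r m)" "-1" g] by (simp add: h_def)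
    ultimately have "(\<lambda>m. bloch_dist (comb k c \<phi> (f (r m))) (comb k c \<phi> g)) \<longlonglongrightarrow> 0"
      using maps f(1) gr(1) by (simp add: bloch_dist_def U_def)
    moreover have "comb k c \<phi> (f m) \<in> bloch_space" "comb k c \<phi> g \<in> bloch_space" for m
      using maps f(1) gr(1) by (auto simp: U_def)
    ultimately have "limitin bloch.mtopology (\<sigma> \<circ> r) (comb k c \<phi> g) sequentially"
      by (simp add: bloch.limitin_metric_dist_null f(2) o_def)
    then show "\<exists>l r. l \<in> comb k c \<phi> ` U \<and> strict_mono r \<and> limitin bloch.mtopology (\<sigma> \<circ> r) l sequentially"
      using gr(1,2) by blast
  qed
  \<comment> \<open>The image of the closed unit ball is itself compact, hence closed.\<close>
  then have "compactin bloch.mtopology (bloch.mtopology closure_of (comb k c \<phi> ` U))"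
    using compactin_imp_closedin[OF bloch.Hausdorff_space_mtopology] by (simp add: closure_of_closedin)
  then show ?thesis
    using maps comb_linear by (auto simp: compact_on_bloch_def linear_on_bloch_def U_def)
qed

lemma power_comb_tendsto_0_of_compact:
  assumes \<phi>: "\<forall>i\<in>{1..k}. analytic_self_map (\<phi> i)"
    and T: "compact_on_bloch (comb k c \<phi>)"
  shows "(\<lambda>n. bloch_norm (power_comb k c \<phi> n)) \<longlonglongrightarrow> 0"
proof -
  define U where "U = {f \<in> bloch_space. bloch_norm f \<le> 1}"
  define K where "K = bloch.mtopology closure_of (comb k c \<phi> ` U)"
  have maps: "comb k c \<phi> ` bloch_space \<subseteq> bloch_space" and K: "compactin bloch.mtopology K"
    using T by (auto simp: compact_on_bloch_def K_def U_def)
  \<comment> \<open>The factor \<open>1/2\<close> puts the powers into the unit ball.\<close>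
  define e where "e = (\<lambda>n z. if z \<in> ball 0 1 then (1/2) * z ^ Suc n else (0::complex))"
  have eU: "e n \<in> U" for n
    unfolding U_def e_def by (rule half_power_unit_ball)
  have comb_e: "comb k c \<phi> (e n) z = (1/2) * power_comb k c \<phi> (Suc n) z" if "z \<in> ball 0 1" for n z
  proof -
    have "\<phi> i z \<in> ball 0 1" if "i \<in> {1..k}" for i
      using self_map_less[OF bspec[OF \<phi> that]] \<open>z \<in> ball 0 1\<close> by simp
    then show ?thesis
      using that by (simp add: comb_inside power_comb_def e_def sum_distrib_left mult_ac)
  qed
  have comb_e_space: "comb k c \<phi> (e n) \<in> bloch_space" for n
    using eU maps by (auto simp: U_def)
  have norm_e: "bloch_norm (power_comb k c \<phi> (Suc n)) \<le> 2 * bloch_norm (comb k c \<phi> (e n))" for n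
    using bloch_norm_scale_le[of "comb k c \<phi> (e n)" "power_comb k c \<phi> (Suc n)" 2] comb_e_space[of n]
    by (simp add: comb_e bloch_space_def)
  have inK: "comb k c \<phi> (e n) \<in> K" for n
    unfolding K_def using closure_of_subset[of "comb k c \<phi> ` U" bloch.mtopology] maps eU
    by (fastforce simp: U_def)
  have "(\<lambda>n. bloch_norm (comb k c \<phi> (e n))) \<longlonglongrightarrow> 0"
  proof (rule ccontr)
    assume "\<not> ?thesis"
    then obtain \<epsilon> where \<epsilon>: "0 < \<epsilon>" "\<And>N. \<exists>n\<ge>N. \<epsilon> \<le> norm (bloch_norm (comb k c \<phi> (e n)) - 0)"
      unfolding LIMSEQ_iff by (auto simp: not_less)
    then have "infinite {n. \<epsilon> \<le> norm (bloch_norm (comb k c \<phi> (e n)) - 0)}"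
      unfolding infinite_nat_iff_unbounded_le by auto
    then obtain s :: "nat \<Rightarrow> nat" where s: "strict_mono s"
      "\<And>n. \<epsilon> \<le> norm (bloch_norm (comb k c \<phi> (e (s n))) - 0)"
      using infinite_enumerate by blast
    have "range (\<lambda>n. comb k c \<phi> (e (s n))) \<subseteq> K"
      using inK by auto
    then obtain l r where l: "strict_mono r"
      "limitin bloch.mtopology ((\<lambda>n. comb k c \<phi> (e (s n))) \<circ> r) l sequentially"
      using K unfolding bloch.compactin_sequentially by meson
    have l_space: "l \<in> bloch_space" and
      lim: "(\<lambda>n. bloch_dist (comb k c \<phi> (e (s (r n)))) l) \<longlonglongrightarrow> 0"
      using l(2) by (auto simp: bloch.limitin_metric_dist_null o_def)
    have sr: "strict_mono (\<lambda>n. s (r n))"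
      using s(1) l(1) by (rule strict_mono_compose)
    have "l z = 0" if z: "z \<in> ball 0 1" for z
    proof -
      have "(\<lambda>n. comb k c \<phi> (e (s (r n))) z) \<longlonglongrightarrow> l z"
        using lim comb_e_space l_space z by (intro bloch_dist_tendsto_pointwise) auto
      moreover have "(\<lambda>n. comb k c \<phi> (e n) z) \<longlonglongrightarrow> (1/2) * (\<Sum>i=1..k. c i * 0)"
        using z self_map_less[OF bspec[OF \<phi>]] unfolding comb_e[OF z] power_comb_def
        by (intro tendsto_intros LIMSEQ_Suc[OF LIMSEQ_power_zero]) auto
      then have "(\<lambda>n. comb k c \<phi> (e (s (r n))) z) \<longlonglongrightarrow> 0"
        using LIMSEQ_subseq_LIMSEQ[OF _ sr] by (fastforce simp: o_def)
      ultimately show "l z = 0"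
        by (rule LIMSEQ_unique)
    qed
    then have "l = (\<lambda>z. 0)"
      using l_space by (auto simp: bloch_space_def fun_eq_iff)
    then have "(\<lambda>n. bloch_norm (comb k c \<phi> (e (s (r n))))) \<longlonglongrightarrow> 0"
      using lim l_space comb_e_space by (simp add: bloch_dist_def)
    then obtain n where "norm (bloch_norm (comb k c \<phi> (e (s (r n)))) - 0) < \<epsilon>"
      using LIMSEQ_D \<epsilon>(1) by blast
    then show False
      using s(2)[of "r n"] by linarith
  qed
  then have "(\<lambda>n. 2 * bloch_norm (comb k c \<phi> (e n))) \<longlonglongrightarrow> 0"
    using tendsto_mult_right_zero by blast
  then have "(\<lambda>n. bloch_norm (power_comb k c \<phi> (Suc n))) \<longlonglongrightarrow> 0"
    by (rule tendsto_sandwich[OF _ _ tendsto_const, rotated 2])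
      (auto simp: norm_e power_comb_bloch[OF \<phi>] bloch_norm_nonneg)
  then show ?thesis
    by (rule LIMSEQ_imp_Suc)
qed

theorem theorem1:
  fixes k :: nat and c :: "nat \<Rightarrow> complex" and \<phi> :: "nat \<Rightarrow> complex \<Rightarrow> complex"
  assumes "k \<ge> 1"
    and "\<And>i. i \<in> {1..k} \<Longrightarrow> c i \<noteq> 0"
    and "\<And>i. i \<in> {1..k} \<Longrightarrow> analytic_self_map (\<phi> i)"
  shows "compact_on_bloch (\<lambda>f z. \<Sum>i=1..k. c i * comp_op (\<phi> i) f z) \<longleftrightarrow>
    (\<lambda>n. bloch_norm (\<lambda>z. \<Sum>i=1..k. c i * \<phi> i z ^ n)) \<longlonglongrightarrow> 0"
proof -
  have "compact_on_bloch (comb k c \<phi>) \<longleftrightarrow>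
      (\<lambda>n. bloch_norm (power_comb k c \<phi> n)) \<longlonglongrightarrow> 0"
    using compact_of_power_comb_tendsto_0[of k \<phi> c] power_comb_tendsto_0_of_compact[of k \<phi> c] assms(3)
    by blast
  then show ?thesis
    unfolding comb_def power_comb_def .
qed

end
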